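(* Let $P=\mathbb F_3^4$ with a nondegenerate alternating form $\omega$, and let $S=(q_1,\ldots,q_{12})$ be a sequence of twelve vectors in $P\setminus\{0\}$ such that, counting occurrences with multiplicity, every one-dimensional subspace of $P$ contains at most $2$ terms of $S$, every isotropic plane contains at most $3$, every nondegenerate plane contains at most $6$, and every hyperplane contains at most $8$. Let $\mathcal K(S)$ and $\mathcal B(S)$ be the family of balanced triples and the graph on $\operatorname{supp}(S)$ defined in the context. Then the cochain $a_{uv}=\omega(u,v)$ on $\mathcal B(S)$ is a gradient over $\mathbb F_3$, i.e. there is a function $p:\operatorname{supp}(S)\to\mathbb F_3$ with \[ \omega(u,v)=p(v)-p(u)\qquad\text{for every edge }\{u,v\}\text{ of }\mathcal B(S). \] Consequently, there are symmetric weights $\rho_{uv}=\rho_{vu}\in\mathbb F_3$, defined on the pairs of values $u,v\in\operatorname{supp}(S)$ with $\omega(u,v)\neq 0$, such that \[ \rho_{uv}+\rho_{vw}+\rho_{wu}=1\qquad\text{for every }\{u,v,w\}\in\mathcal K(S). \]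
   Context: All subspaces are linear subspaces; a plane is a two-dimensional subspace, a hyperplane a three-dimensional subspace. A plane is isotropic if $\omega$ restricts to zero on it, and nondegenerate if the restriction of $\omega$ is nondegenerate. A sequence is a list with repetitions allowed; $\operatorname{supp}(S)$ is the set of distinct vector values occurring in $S$ and $\operatorname{mult}_S(x)$ is the number of occurrences of $x$ in $S$. A triple $(u,v,w)$ is balanced if $\omega(u,v)=\omega(v,w)=\omega(w,u)\neq 0$; this property is invariant under reordering the three vectors. $\mathcal K(S)$ is the family of all three-element subsets $\{u,v,w\}$ of $\operatorname{supp}(S)$ (distinct vector values) that are balanced and for which, with $t=u+v+w$, either $t=0$, or $t\neq0$ and ($\operatorname{mult}_S(-t)\ge 1$ or $\operatorname{mult}_S(t)\ge 2$). $\mathcal B(S)$ is the graph whose vertices are the values in $\operatorname{supp}(S)$ and whose edges are the pairs $\{u,v\}$ contained in at least three members of $\mathcal K(S)$. *)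

theory Defs
  imports "HOL-Analysis.Cartesian_Space" "HOL-Library.Numeral_Type"
begin

definition alternating_form :: "('k::field ^ 'n::finite \<Rightarrow> 'k ^ 'n \<Rightarrow> 'k) \<Rightarrow> bool" where
  "alternating_form \<omega> \<longleftrightarrow>
     (\<forall>x. Vector_Spaces.linear (*s) (*) (\<lambda>y. \<omega> x y)) \<and>
     (\<forall>y. Vector_Spaces.linear (*s) (*) (\<lambda>x. \<omega> x y)) \<and>
     (\<forall>x. \<omega> x x = 0)"

text \<open>One-sided nondegeneracy suffices, as it is applied to alternating forms only.\<close>

definition nondegenerate_on :: "('k::field ^ 'n::finite \<Rightarrow> 'k ^ 'n \<Rightarrow> 'k) \<Rightarrow> ('k ^ 'n) set \<Rightarrow> bool" where
  "nondegenerate_on \<omega> U \<longleftrightarrow> (\<forall>x\<in>U. (\<forall>y\<in>U. \<omega> x y = 0) \<longrightarrow> x = 0)"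

definition isotropic :: "('k::field ^ 'n::finite \<Rightarrow> 'k ^ 'n \<Rightarrow> 'k) \<Rightarrow> ('k ^ 'n) set \<Rightarrow> bool" where
  "isotropic \<omega> U \<longleftrightarrow> (\<forall>x\<in>U. \<forall>y\<in>U. \<omega> x y = 0)"

definition subspace_of_dim :: "nat \<Rightarrow> ('k::field ^ 'n::finite) set \<Rightarrow> bool" where
  "subspace_of_dim d U \<longleftrightarrow> vec.subspace U \<and> vec.dim U = d"

definition terms_in :: "'a list \<Rightarrow> 'a set \<Rightarrow> nat" where
  "terms_in S U = length (filter (\<lambda>q. q \<in> U) S)"

definition balanced :: "('k::field ^ 'n::finite \<Rightarrow> 'k ^ 'n \<Rightarrow> 'k) \<Rightarrow> 'k ^ 'n \<Rightarrow> 'k ^ 'n \<Rightarrow> 'k ^ 'n \<Rightarrow> bool" where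
  "balanced \<omega> u v w \<longleftrightarrow> \<omega> u v = \<omega> v w \<and> \<omega> v w = \<omega> w u \<and> \<omega> w u \<noteq> 0"

text \<open>Both conditions on the triple are invariant under permuting its vectors, so it does not matter
  which enumeration of the set the existential quantifier picks.\<close>

definition balanced_triples ::
  "('k::field ^ 'n::finite \<Rightarrow> 'k ^ 'n \<Rightarrow> 'k) \<Rightarrow> ('k ^ 'n) list \<Rightarrow> ('k ^ 'n) set set" where
  "balanced_triples \<omega> S =
     {T. \<exists>u v w. T = {u, v, w} \<and> T \<subseteq> set S \<and> u \<noteq> v \<and> v \<noteq> w \<and> w \<noteq> u \<and> balanced \<omega> u v w \<and>
        (let t = u + v + w in
           t = 0 \<or> t \<noteq> 0 \<and> (count_list S (- t) \<ge> 1 \<or> count_list S t \<ge> 2))}"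

text \<open>Edge set of the graph; its vertex set is \<^term>\<open>set S\<close>.\<close>

definition triple_graph_edges ::
  "('k::field ^ 'n::finite \<Rightarrow> 'k ^ 'n \<Rightarrow> 'k) \<Rightarrow> ('k ^ 'n) list \<Rightarrow> ('k ^ 'n) set set" where
  "triple_graph_edges \<omega> S =
     {e. \<exists>u\<in>set S. \<exists>v\<in>set S. e = {u, v} \<and> u \<noteq> v \<and> card {T \<in> balanced_triples \<omega> S. e \<subseteq> T} \<ge> 3}"

end

theory Submission
  imports Defs "HOL-Library.Multiset"
begin

text \<open>Let \<open>u, v\<close> be an edge and \<open>c = \<omega> u v\<close>. The triples of the family that contain \<open>u\<close> and \<open>v\<close> are
  given by the third vertices \<open>w = t - (u + v)\<close> with \<open>t\<close> in the nondegenerate plane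
  \<open>\<langle>u, v\<rangle>\<^sup>\<bottom>\<close>, where \<open>t = 0\<close> or \<open>t\<close> is witnessed by terms of the sequence on the line \<open>\<langle>t\<rangle>\<close>. The
  bound for the isotropic plane \<open>\<langle>t, u + v\<rangle>\<close> shows that \<open>t\<close> and \<open>-t\<close> do not both occur for
  \<open>t \<noteq> 0\<close> (\<open>closing_not_opposite\<close>). Hence three of the sums \<open>t\<close> are \<open>a\<close>, \<open>b\<close> and one of \<open>0\<close>, \<open>a + b\<close>,
  \<open>-(a + b)\<close> for a basis \<open>a, b\<close> of the plane with \<open>\<omega> a b = c\<close> (\<open>three_sums_normal_form\<close>).
  In the coordinates with respect to the basis \<open>u, v, a, b\<close>, an edge fixes at least
  seven of the twelve terms up to a few choices. Every further edge of a walk that starts with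
  \<open>u, v\<close> forces further terms, and the isotropic planes and the length twelve leave so little
  room that a search over all possibilities ends quickly. Its outcome (\<open>no_walk\<close>): if a walk has six
  edges and never backtracks, then it closes a triangle \<open>x, y, z\<close> with \<open>x + y + z = 0\<close> somewhere.

  If the cochain were not a gradient, there would be a closed walk along which it has nonzero
  sum. A shortest one visits no vertex twice and has length at least three; repeated
  periodically it never backtracks, so it is a triangle \<open>x, y, z\<close> with \<open>x + y + z = 0\<close>. But then
  \<open>\<omega> x y = \<omega> y z = \<omega> z x\<close>, and the sum is \<open>3 * \<omega> x y = 0\<close> (\<open>closed_walk_sum\<close>).

  The weights solve a system of linear equations over the field, one for each triple. By the Fredholm
  alternative they exist if every linear relation between the left-hand sides has coefficient
  sum zero. A relation is lifted to integers and paired with the potential of the first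
  part (\<open>relation_sum_zero\<close>); pairs that are not edges lie in at most two triples, and drop out.\<close>

section \<open>Coordinates over the field with three elements\<close>

text \<open>The field with three elements as an explicit datatype (\<^term>\<open>T2\<close> stands for \<open>-1\<close>), and the
  symplectic space of dimension four over it, with symplectic basis \<open>e1, e2, e3, e4\<close>. The functions
  of this and the next section that the search evaluates are written with a view to evaluation by
  rewriting: in the inner loops they recurse directly on lists, and conditionals replace
  conjunctions wherever evaluation should be lazy.\<close>

datatype trit = T0 | T1 | T2

fun tadd :: "trit \<Rightarrow> trit \<Rightarrow> trit" where
  "tadd T0 b = b"
| "tadd a T0 = a"
| "tadd T1 T1 = T2"
| "tadd T2 T2 = T1"
| "tadd T1 T2 = T0"
| "tadd T2 T1 = T0"

fun tneg :: "trit \<Rightarrow> trit" where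
  "tneg T0 = T0"
| "tneg T1 = T2"
| "tneg T2 = T1"

fun tmul :: "trit \<Rightarrow> trit \<Rightarrow> trit" where
  "tmul T0 b = T0"
| "tmul a T0 = T0"
| "tmul T1 b = b"
| "tmul T2 b = tneg b"

fun teq :: "trit \<Rightarrow> trit \<Rightarrow> bool" where
  "teq T0 T0 = True"
| "teq T1 T1 = True"
| "teq T2 T2 = True"
| "teq _ _ = False"

datatype vec4 = V trit trit trit trit

fun vadd :: "vec4 \<Rightarrow> vec4 \<Rightarrow> vec4" where
  "vadd (V a b c d) (V a' b' c' d') = V (tadd a a') (tadd b b') (tadd c c') (tadd d d')"

fun vneg :: "vec4 \<Rightarrow> vec4" where
  "vneg (V a b c d) = V (tneg a) (tneg b) (tneg c) (tneg d)"

fun om :: "vec4 \<Rightarrow> vec4 \<Rightarrow> trit" where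
  "om (V a b c d) (V a' b' c' d') =
     tadd (tadd (tmul a b') (tneg (tmul b a'))) (tadd (tmul c d') (tneg (tmul d c')))"

fun veq :: "vec4 \<Rightarrow> vec4 \<Rightarrow> bool" where
  "veq (V a b c d) (V a' b' c' d') =
     (if teq a a' then if teq b b' then if teq c c' then teq d d' else False else False else False)"

definition v0 :: vec4 where "v0 = V T0 T0 T0 T0"
definition e1 :: vec4 where "e1 = V T1 T0 T0 T0"
definition e2 :: vec4 where "e2 = V T0 T1 T0 T0"
definition e3 :: vec4 where "e3 = V T0 T0 T1 T0"
definition e4 :: vec4 where "e4 = V T0 T0 T0 T1"

definition vecs :: "vec4 list" where
  "vecs = [V a b c d. a \<leftarrow> [T0, T1, T2], b \<leftarrow> [T0, T1, T2], c \<leftarrow> [T0, T1, T2], d \<leftarrow> [T0, T1, T2]]"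

lemma teq_iff [simp]: "teq a b \<longleftrightarrow> a = b"
  by (cases a; cases b) simp_all

lemma veq_iff [simp]: "veq x y \<longleftrightarrow> x = y"
  by (cases x; cases y) simp

lemma set_vecs [simp]: "set vecs = UNIV"
proof -
  have trit: "a \<in> {T0, T1, T2}" for a by (cases a) simp_all
  have "V a b c d \<in> set vecs" for a b c d
    using trit[of a] trit[of b] trit[of c] trit[of d] unfolding vecs_def set_concat set_map by fastforce
  then show ?thesis by (metis UNIV_eq_I vec4.exhaust)
qed

lemma tadd_comm: "tadd a b = tadd b a"
  by (cases a; cases b) simp_all

lemma tadd_assoc: "tadd (tadd a b) c = tadd a (tadd b c)"
  by (cases a; cases b; cases c) simp_all

lemma tadd_left_comm: "tadd a (tadd b c) = tadd b (tadd a c)"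
  by (metis tadd_assoc tadd_comm)

lemmas tadd_ac = tadd_comm tadd_assoc tadd_left_comm

lemma tneg_tneg [simp]: "tneg (tneg a) = a"
  by (cases a) simp_all

lemma tneg_tadd: "tneg (tadd a b) = tadd (tneg a) (tneg b)"
  by (cases a; cases b) simp_all

lemma tadd_tneg [simp]: "tadd a (tneg a) = T0"
  by (cases a) simp_all

lemma tneg_tadd_self [simp]: "tadd (tneg a) a = T0"
  by (cases a) simp_all

lemma tmul_comm: "tmul a b = tmul b a"
  by (cases a; cases b) simp_all

lemma tmul_tadd: "tmul a (tadd b c) = tadd (tmul a b) (tmul a c)"
  by (cases a; cases b; cases c) simp_all

lemma tmul_tneg: "tmul a (tneg b) = tneg (tmul a b)"
  by (cases a; cases b) simp_all

lemma om_vadd: "om x (vadd y z) = tadd (om x y) (om x z)"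
  by (cases x; cases y; cases z) (simp add: tmul_tadd tneg_tadd tadd_ac)

lemma om_swap: "om y x = tneg (om x y)"
  by (cases x; cases y) (simp add: tneg_tadd tmul_comm tadd_ac)

lemma om_self [simp]: "om x x = T0"
  by (cases x) (simp add: tmul_comm)

lemma om_vneg: "om x (vneg y) = tneg (om x y)"
  by (cases x; cases y) (simp add: tmul_tneg tneg_tadd)

lemma vadd_left_cancel [simp]: "vadd x y = vadd x z \<longleftrightarrow> y = z"
proof -
  have "tadd a b = tadd a c \<longleftrightarrow> b = c" for a b c by (cases a; cases b; cases c) simp_all
  then show ?thesis by (cases x; cases y; cases z) simp
qed

lemma vneg_inject [simp]: "vneg x = vneg y \<longleftrightarrow> x = y"
proof -
  have "tneg a = tneg b \<longleftrightarrow> a = b" for a b by (cases a; cases b) simp_all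
  then show ?thesis by (cases x; cases y) simp
qed

section \<open>The search for walks\<close>

fun mem :: "vec4 \<Rightarrow> vec4 list \<Rightarrow> bool" where
  "mem x [] = False"
| "mem x (y # ys) = (if veq x y then True else mem x ys)"

fun twice :: "vec4 \<Rightarrow> vec4 list \<Rightarrow> bool" where
  "twice x [] = False"
| "twice x (y # ys) = (if veq x y then mem x ys else twice x ys)"

fun dedup :: "vec4 list \<Rightarrow> vec4 list" where
  "dedup [] = []"
| "dedup (x # xs) = (if mem x xs then dedup xs else x # dedup xs)"

fun perp :: "vec4 \<Rightarrow> vec4 list \<Rightarrow> vec4 list" where
  "perp x [] = []"
| "perp x (y # ys) = (if teq (om x y) T0 then y # perp x ys else perp x ys)"

fun fiber :: "vec4 \<Rightarrow> vec4 \<Rightarrow> trit \<Rightarrow> trit \<Rightarrow> vec4 list \<Rightarrow> vec4 list" where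
  "fiber u v a b [] = []"
| "fiber u v a b (z # zs) =
     (if teq (om u z) a then if teq (om v z) b then z # fiber u v a b zs else fiber u v a b zs
      else fiber u v a b zs)"

text \<open>Comparison of lengths and truncated subtraction of lengths, with lists as unary numbers.\<close>

fun fits :: "'a list \<Rightarrow> 'b list \<Rightarrow> bool" where
  "fits [] ys = True"
| "fits (x # xs) [] = False"
| "fits (x # xs) (y # ys) = fits xs ys"

fun lack :: "'a list \<Rightarrow> 'b list \<Rightarrow> 'a list" where
  "lack [] ys = []"
| "lack (x # xs) [] = x # xs"
| "lack (x # xs) (y # ys) = lack xs ys"

definition twelve :: "unit list" where
  "twelve = [(), (), (), (), (), (), (), (), (), (), (), ()]"

text \<open>A state of the search is a list of vectors that are known to occur in the sequence, counted
  with multiplicity.\<close>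

definition known :: "vec4 list \<Rightarrow> vec4 list \<Rightarrow> bool" where
  "known st S \<longleftrightarrow> mset st \<subseteq># mset S"

text \<open>The least state that refines \<open>st\<close> and contains \<open>x\<close>, and the least one that contains \<open>x\<close> twice.\<close>

definition need :: "vec4 \<Rightarrow> vec4 list \<Rightarrow> vec4 list" where
  "need x st = (if mem x st then st else x # st)"

definition need2 :: "vec4 \<Rightarrow> vec4 list \<Rightarrow> vec4 list" where
  "need2 x st = (if twice x st then st else if mem x st then x # st else x # x # st)"

text \<open>Lists of states are alternatives; a state with more than twelve vectors is impossible.\<close>

definition keep :: "vec4 list \<Rightarrow> vec4 list list" where
  "keep st = (if fits st twelve then [st] else [])"

text \<open>The sum \<open>t\<close> of a triple is zero, or \<open>-t\<close> is a term, or \<open>t\<close> occurs twice.\<close>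

definition witness :: "vec4 \<Rightarrow> vec4 list \<Rightarrow> vec4 list list" where
  "witness t st = (if veq t v0 then keep st else keep (need (vneg t) st) @ keep (need2 t st))"

text \<open>The refinements of a state containing \<open>u\<close> and \<open>v\<close> in which \<open>{u, v, w}\<close> is a triple of the family;
  that the triple is balanced is left to the choice of \<open>w\<close>.\<close>

definition realize :: "vec4 \<Rightarrow> vec4 \<Rightarrow> vec4 \<Rightarrow> vec4 list \<Rightarrow> vec4 list list" where
  "realize u v w st = witness (vadd u (vadd v w)) (need w st)"

text \<open>The vectors \<open>w\<close> that can be added as third vertices without exceeding twelve terms.\<close>

fun affordable :: "vec4 \<Rightarrow> vec4 \<Rightarrow> vec4 list \<Rightarrow> vec4 list \<Rightarrow> vec4 list" where
  "affordable u v [] st = []"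
| "affordable u v (w # ws) st =
     (if realize u v w st = [] then affordable u v ws st else w # affordable u v ws st)"

text \<open>Refinements of a state in which as many vectors of \<open>ws\<close> as the unary number \<open>ks\<close> says are third
  vertices.\<close>

fun pick :: "vec4 \<Rightarrow> vec4 \<Rightarrow> unit list \<Rightarrow> vec4 list \<Rightarrow> vec4 list \<Rightarrow> vec4 list list" where
  "pick u v [] ws st = [st]"
| "pick u v (k # ks) [] st = []"
| "pick u v (k # ks) (w # ws) st =
     (if fits (k # ks) (w # ws)
      then pick u v (k # ks) ws st @ concat (map (pick u v ks ws) (realize u v w st)) else [])"

text \<open>The bound for isotropic planes \<open>\<langle>x, y\<rangle>\<close>, with \<open>y\<close> in the list \<open>N\<close> of all
  known vectors orthogonal to \<open>x\<close>. The terms of \<open>\<langle>x, y\<rangle>\<close> are those orthogonal to \<open>x\<close> and \<open>y\<close>. The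
  bound is tested for the vectors \<open>x\<close> that are new in comparison with the state \<open>st0\<close>: states grow at
  the front.\<close>

fun planes_ok :: "vec4 \<Rightarrow> vec4 list \<Rightarrow> vec4 list \<Rightarrow> bool" where
  "planes_ok x N [] = True"
| "planes_ok x N (y # ys) =
     (if veq y x then planes_ok x N ys else if veq y (vneg x) then planes_ok x N ys
      else if fits (perp y N) [(), (), ()] then planes_ok x N ys else False)"

fun point_ok :: "vec4 \<Rightarrow> vec4 list \<Rightarrow> bool" where
  "point_ok x N = planes_ok x N N"

fun new_ok :: "vec4 list \<Rightarrow> vec4 list \<Rightarrow> vec4 list \<Rightarrow> bool" where
  "new_ok st0 [] st = True"
| "new_ok st0 (x # xs) st =
     (if fits (x # xs) st0 then True else if point_ok x (perp x st) then new_ok st0 xs st else False)"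

fun isotropic_filter :: "vec4 list \<Rightarrow> vec4 list list \<Rightarrow> vec4 list list" where
  "isotropic_filter st0 [] = []"
| "isotropic_filter st0 (s # ss) =
     (if new_ok st0 s s then s # isotropic_filter st0 ss else isotropic_filter st0 ss)"

text \<open>An edge \<open>u, v\<close> with \<open>om u v = c\<close> needs three terms \<open>w\<close> with \<open>om u w = -c\<close> and \<open>om v w = c\<close>, and
  two terms orthogonal to \<open>u\<close> and \<open>v\<close>: this gives a quick necessary condition for an edge. The
  missing terms are represented by \<^term>\<open>v0\<close>; only their number matters.\<close>

definition room :: "vec4 \<Rightarrow> vec4 \<Rightarrow> trit \<Rightarrow> vec4 list \<Rightarrow> bool" where
  "room u v c st =
     fits (lack [v0, v0, v0] (fiber u v (tneg c) c st) @ lack [v0, v0] (fiber u v T0 T0 st) @ st) twelve"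

text \<open>The vectors that may occur in the sequence; a state of twelve vectors is the whole sequence.\<close>

definition cands :: "vec4 list \<Rightarrow> vec4 list" where
  "cands st = (if fits (v0 # st) twelve then vecs else dedup st)"

definition supports' :: "vec4 \<Rightarrow> vec4 \<Rightarrow> trit \<Rightarrow> vec4 list \<Rightarrow> vec4 list \<Rightarrow> vec4 list list" where
  "supports' u v c st0 st =
     (if room u v c st
      then isotropic_filter st0
             (pick u v [(), (), ()] (affordable u v (fiber u v (tneg c) c (cands st)) st) st)
      else [])"

text \<open>The refinements of a state in which \<open>u, v\<close> is an edge.\<close>

definition supports :: "vec4 \<Rightarrow> vec4 \<Rightarrow> vec4 list \<Rightarrow> vec4 list list" where
  "supports u v st = supports' u v (om u v) st (need u (need v st))"

text \<open>Steps from \<open>r\<close> to \<open>z\<close> that need no consideration: non-edges, backtracking, and closing a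
  triangle with vertex sum zero.\<close>

fun skip :: "vec4 \<Rightarrow> vec4 \<Rightarrow> vec4 \<Rightarrow> vec4 \<Rightarrow> bool" where
  "skip p q r z =
     (if teq (om r z) T0 then True else if veq z q then True
      else if veq z p then veq (vadd p (vadd q r)) v0 else False)"

text \<open>No continuation of the walk \<open>p, q, r\<close> by \<open>n\<close> edges is consistent with the state \<open>st\<close>.\<close>

fun dead_end :: "nat \<Rightarrow> vec4 \<Rightarrow> vec4 \<Rightarrow> vec4 \<Rightarrow> vec4 list \<Rightarrow> bool" where
  "dead_end 0 p q r st = False"
| "dead_end (Suc n) p q r st =
     list_all (\<lambda>z. if skip p q r z then True else list_all (dead_end n q r z) (supports r z st))
       (cands st)"

text \<open>The vector that forms a triple with \<open>e1\<close>, \<open>e2\<close> and has sum \<open>t\<close> with them.\<close>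

definition third_at :: "vec4 \<Rightarrow> vec4" where
  "third_at t = vadd (vneg (vadd e1 e2)) t"

text \<open>The states in which \<open>e1, e2\<close> is an edge by three triples with sums \<open>e3\<close>, \<open>e4\<close> and \<open>r\<close>.\<close>

definition starts :: "vec4 \<Rightarrow> vec4 list list" where
  "starts r = isotropic_filter [e1, e2]
     (pick e1 e2 [(), (), ()] [third_at e3, third_at e4, third_at r] [e1, e2])"

section \<open>Completeness of the search\<close>

text \<open>The coordinate versions of the hypotheses, of the triples \<open>{u, v, w}\<close> of the family that contain
  a given pair \<open>u, v\<close> with \<open>om u v \<noteq> 0\<close>, and of the edges of the graph.\<close>

definition admissible :: "vec4 list \<Rightarrow> bool" where
  "admissible S \<longleftrightarrow> length S = 12 \<and> v0 \<notin> set S \<and>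
     (\<forall>x\<in>set S. \<forall>y\<in>set S. om x y = T0 \<longrightarrow> y \<noteq> x \<longrightarrow> y \<noteq> vneg x \<longrightarrow>
        length (filter (\<lambda>z. om x z = T0 \<and> om y z = T0) S) \<le> 3)"

definition third :: "vec4 list \<Rightarrow> vec4 \<Rightarrow> vec4 \<Rightarrow> vec4 \<Rightarrow> bool" where
  "third S u v w \<longleftrightarrow> w \<in> set S \<and> om v w = om u v \<and> om w u = om u v \<and>
     (let t = vadd u (vadd v w) in t = v0 \<or> vneg t \<in> set S \<or> count_list S t \<ge> 2)"

definition edge4 :: "vec4 list \<Rightarrow> vec4 \<Rightarrow> vec4 \<Rightarrow> bool" where
  "edge4 S u v \<longleftrightarrow> u \<in> set S \<and> v \<in> set S \<and> om u v \<noteq> T0 \<and> card {w. third S u v w} \<ge> 3"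

lemma third_fiber: "third S u v w \<Longrightarrow> w \<in> set S \<and> om u w = tneg (om u v) \<and> om v w = om u v"
  by (simp add: third_def om_swap[of u w])

lemma third_sum_perp:
  assumes "third S u v w"
  shows "om u (vadd u (vadd v w)) = T0 \<and> om v (vadd u (vadd v w)) = T0"
  using third_fiber[OF assms] om_swap[of v u] by (simp add: om_vadd)

lemma mem_iff [simp]: "mem x xs \<longleftrightarrow> x \<in> set xs"
  by (induction xs) auto

lemma twice_iff [simp]: "twice x xs \<longleftrightarrow> count (mset xs) x \<ge> 2"
  by (induction xs) (auto simp: numeral_2_eq_2 Suc_le_eq)

lemma set_dedup [simp]: "set (dedup xs) = set xs"
  by (induction xs) auto

lemma perp_eq: "perp x xs = filter (\<lambda>y. om x y = T0) xs"
  by (induction xs) auto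

lemma fiber_eq: "fiber u v a b zs = filter (\<lambda>z. om u z = a \<and> om v z = b) zs"
  by (induction zs) auto

lemma fits_iff [simp]: "fits xs ys \<longleftrightarrow> length xs \<le> length ys"
  by (induction xs ys rule: fits.induct) auto

lemma length_lack [simp]: "length (lack xs ys) = length xs - length ys"
  by (induction xs ys rule: lack.induct) auto

lemma length_twelve [simp]: "length twelve = 12"
  by (simp add: twelve_def)

lemma known_set: "known st S \<Longrightarrow> x \<in> set st \<Longrightarrow> x \<in> set S"
  unfolding known_def by (metis mset_subset_eqD set_mset_mset)

lemma known_filter: "known st S \<Longrightarrow> length (filter P st) \<le> length (filter P S)"
  unfolding known_def by (metis mset_filter multiset_filter_mono size_mset size_mset_mono)

lemma known_length: "known st S \<Longrightarrow> length st \<le> length S"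
  using known_filter[of st S "\<lambda>_. True"] by simp

lemma known_iff: "known st S \<longleftrightarrow> (\<forall>x. count (mset st) x \<le> count (mset S) x)"
  by (simp add: known_def subseteq_mset_def)

lemma known_need:
  assumes "known st S" and "x \<in> set S"
  shows "known (need x st) S"
proof -
  have S: "count (mset S) x \<ge> 1" using assms(2) by (simp add: Suc_le_eq)
  show ?thesis
  proof (cases "x \<in> set st")
    case False
    then have "count (mset st) x = 0" by (simp add: count_eq_zero_iff)
    then have "count (mset st) x + 1 \<le> count (mset S) x" using S by linarith
    then show ?thesis using assms(1) False by (simp add: known_iff need_def)
  qed (use assms in \<open>simp add: need_def\<close>)
qed

lemma known_need2:
  assumes "known st S" and "count_list S x \<ge> 2"
  shows "known (need2 x st) S"
proof -
  have S: "count (mset S) x \<ge> 2" using assms(2) by (simp add: count_mset)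
  consider "count (mset st) x \<ge> 2" | "count (mset st) x = 1" | "count (mset st) x = 0"
    by linarith
  then show ?thesis
  proof cases
    case 2
    then have "x \<in> set st" by (metis count_eq_zero_iff set_mset_mset zero_neq_one)
    moreover have "count (mset st) x + 1 \<le> count (mset S) x" using S 2 by linarith
    ultimately show ?thesis using assms(1) 2 by (simp add: known_iff need2_def)
  next
    case 3
    then have "x \<notin> set st" by (simp add: count_eq_zero_iff)
    moreover have "count (mset st) x + 2 \<le> count (mset S) x" using S 3 by linarith
    ultimately show ?thesis using assms(1) by (simp add: known_iff need2_def)
  qed (use assms in \<open>simp add: need2_def\<close>)
qed

lemma known_keep: "known st S \<Longrightarrow> length S = 12 \<Longrightarrow> st \<in> set (keep st)"
  using known_length[of st S] by (simp add: keep_def)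

lemma realize_complete:
  assumes "third S u v w" "known st S" "length S = 12"
  shows "\<exists>s \<in> set (realize u v w st). known s S"
proof -
  define t where "t = vadd u (vadd v w)"
  have w: "known (need w st) S" using assms by (auto simp: third_def intro: known_need)
  have "t = v0 \<or> vneg t \<in> set S \<or> count_list S t \<ge> 2"
    using assms(1) by (simp add: third_def t_def Let_def)
  then consider "t = v0" | "t \<noteq> v0" "vneg t \<in> set S" | "t \<noteq> v0" "count_list S t \<ge> 2"
    by blast
  then show ?thesis
  proof cases
    case 1
    then show ?thesis
      using known_keep[OF w assms(3)] w by (auto simp: realize_def witness_def t_def[symmetric])
  next
    case 2
    have k: "known (need (vneg t) (need w st)) S" using known_need[OF w 2(2)] .
    then show ?thesis
      using known_keep[OF k assms(3)] 2 by (auto simp: realize_def witness_def t_def[symmetric])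
  next
    case 3
    have k: "known (need2 t (need w st)) S" using known_need2[OF w 3(2)] .
    then show ?thesis
      using known_keep[OF k assms(3)] 3 by (auto simp: realize_def witness_def t_def[symmetric])
  qed
qed

lemma affordable_complete:
  assumes "known st S" "length S = 12" "w \<in> set ws" "third S u v w"
  shows "w \<in> set (affordable u v ws st)"
proof -
  have "realize u v w st \<noteq> []" using realize_complete[OF assms(4,1,2)] by auto
  then show ?thesis using assms(3) by (induction ws) auto
qed

lemma pick_complete:
  assumes "length S = 12" "known st S" "length ks \<le> card {w \<in> set ws. third S u v w}"
  shows "\<exists>s \<in> set (pick u v ks ws st). known s S"
  using assms(2,3)
proof (induction u v ks ws st rule: pick.induct)
  case (1 u v ws st)
  then show ?case by simp
next
  case (2 u v k ks st)
  then show ?case by simp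
next
  case (3 u v k ks w ws st)
  have "card {x \<in> set (w # ws). third S u v x} \<le> card (set (w # ws))"
    by (rule card_mono) auto
  also have "\<dots> \<le> length (w # ws)" by (rule card_length)
  finally have fits: "fits (k # ks) (w # ws)" using "3.prems"(2) by simp
  show ?case
  proof (cases "third S u v w")
    case True
    obtain s where s: "s \<in> set (realize u v w st)" "known s S"
      using realize_complete[OF True "3.prems"(1) assms(1)] by blast
    have "{x \<in> set (w # ws). third S u v x} \<subseteq> insert w {x \<in> set ws. third S u v x}" by auto
    then have "card {x \<in> set (w # ws). third S u v x} \<le> card (insert w {x \<in> set ws. third S u v x})"
      by (intro card_mono) auto
    also have "\<dots> \<le> Suc (card {x \<in> set ws. third S u v x})"
      by (simp add: card_insert_if)
    finally have "card {x \<in> set (w # ws). third S u v x} \<le> Suc (card {x \<in> set ws. third S u v x})" .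
    then have "length ks \<le> card {x \<in> set ws. third S u v x}" using "3.prems"(2) by simp
    then have "\<exists>s' \<in> set (pick u v ks ws s). known s' S" using "3.IH"(2)[OF fits s(1) s(2)] by blast
    then show ?thesis using fits s(1) by auto
  next
    case False
    then have "{x \<in> set (w # ws). third S u v x} = {x \<in> set ws. third S u v x}" by auto
    then show ?thesis using "3.IH"(1)[OF fits "3.prems"(1)] "3.prems"(2) fits by auto
  qed
qed

lemma planes_ok_known:
  assumes "admissible S" "known st S" "x \<in> set S" "set ys \<subseteq> set (perp x st)"
  shows "planes_ok x (perp x st) ys"
  using assms(4)
proof (induction ys)
  case (Cons y ys)
  have y: "y \<in> set S" "om x y = T0" using Cons.prems known_set[OF assms(2)] by (auto simp: perp_eq)
  have "length (perp y (perp x st)) \<le> length (filter (\<lambda>z. om x z = T0 \<and> om y z = T0) S)"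
    using known_filter[OF assms(2)] by (simp add: perp_eq conj_commute)
  moreover have "y = x \<or> y = vneg x \<or> length (filter (\<lambda>z. om x z = T0 \<and> om y z = T0) S) \<le> 3"
    using assms(1,3) y unfolding admissible_def by blast
  ultimately show ?case using Cons by auto
qed simp

lemma new_ok_known:
  assumes "admissible S" "known st S" "set xs \<subseteq> set st"
  shows "new_ok st0 xs st"
  using assms(3)
proof (induction xs)
  case (Cons x xs)
  then show ?case
    using planes_ok_known[OF assms(1,2)] known_set[OF assms(2)] by auto
qed simp

lemma isotropic_filter_complete:
  assumes "admissible S" "\<exists>s \<in> set ss. known s S"
  shows "\<exists>s \<in> set (isotropic_filter st0 ss). known s S"
  using assms(2)
proof (induction ss)
  case (Cons s ss)
  then show ?case using new_ok_known[OF assms(1)] by auto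
qed simp

lemma finite_third [simp]: "finite {w. third S u v w}"
  by (rule finite_subset[of _ "set S"]) (auto simp: third_def)

lemma room_complete:
  assumes "edge4 S u v" "known st S" "length S = 12"
  shows "room u v (om u v) st"
proof -
  let ?c = "om u v"
  let ?C = "\<lambda>z. om u z = tneg ?c \<and> om v z = ?c" and ?W = "\<lambda>z. om u z = T0 \<and> om v z = T0"
  have c: "?c \<noteq> T0" and three: "card {w. third S u v w} \<ge> 3" using assms(1) by (auto simp: edge4_def)
  have "{w. third S u v w} \<subseteq> set (filter ?C S)"
    by (auto dest: third_fiber)
  then have C: "3 \<le> length (filter ?C S)"
    using three card_mono[of "set (filter ?C S)" "{w. third S u v w}"] card_length[of "filter ?C S"]
    by simp
  have W: "2 \<le> length (filter ?W S)"
  proof -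
    \<comment> \<open>Of two different nonzero sums, one occurs twice, or both negatives are terms.\<close>
    define I where "I = (\<lambda>w. vadd u (vadd v w)) ` {w. third S u v w}"
    define T where "T = I - {v0}"
    have "card I \<ge> 3"
      using three unfolding I_def by (subst card_image) (auto simp: inj_on_def)
    then have "card T \<ge> 2"
      unfolding T_def using diff_card_le_card_Diff[of "{v0}" I] by simp
    have T: "?W t \<and> (vneg t \<in> set S \<or> count_list S t \<ge> 2)" if "t \<in> T" for t
      using that third_sum_perp by (auto simp: T_def I_def third_def Let_def)
    show ?thesis
    proof (cases "\<exists>t\<in>T. count_list S t \<ge> 2")
      case True
      then obtain t where t: "t \<in> T" "count_list S t \<ge> 2" by blast
      have "length (filter ((=) t) (filter ?W S)) = count_list S t"
        using T[OF t(1)] by (auto simp: count_list_eq_length_filter intro!: arg_cong[of _ _ length] filter_cong)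
      then show ?thesis using t(2) length_filter_le[of "(=) t" "filter ?W S"] by linarith
    next
      case False
      have "vneg ` T \<subseteq> set (filter ?W S)" using T False by (auto simp: om_vneg)
      then have "card (vneg ` T) \<le> card (set (filter ?W S))" by (intro card_mono) auto
      moreover have "card (vneg ` T) = card T" by (intro card_image) (auto simp: inj_on_def)
      ultimately show ?thesis using \<open>card T \<ge> 2\<close> card_length[of "filter ?W S"] by linarith
    qed
  qed
  have split: "length l = length (filter ?C l) + length (filter ?W l) + length (filter (\<lambda>z. \<not> ?C z \<and> \<not> ?W z) l)" for l
    using c by (induction l) auto
  have "length st - length (filter ?C st) - length (filter ?W st) \<le> length S - length (filter ?C S) - length (filter ?W S)"
    using split[of st] split[of S] known_filter[OF assms(2), of "\<lambda>z. \<not> ?C z \<and> \<not> ?W z"] by linarith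
  then show ?thesis
    using C W split[of st] split[of S] known_filter[OF assms(2), of ?C] known_filter[OF assms(2), of ?W] assms(3)
    by (simp add: room_def fiber_eq)
qed

lemma set_cands:
  assumes "known st S" "length S = 12" "x \<in> set S"
  shows "x \<in> set (cands st)"
proof (cases "length st < 12")
  case False
  then have "size (mset st) = size (mset S)" using known_length[OF assms(1)] assms(2) by simp
  then have "mset st = mset S"
    using assms(1) unfolding known_def by (metis subset_mset.le_imp_less_or_eq mset_subset_size nat_neq_iff)
  then show ?thesis using assms(3) False by (auto simp: cands_def dest: mset_eq_setD)
qed (simp add: cands_def)

lemma supports_complete:
  assumes "admissible S" "edge4 S u v" "known st S"
  shows "\<exists>s \<in> set (supports u v st). known s S"
proof -
  let ?st = "need u (need v st)" and ?c = "om u v"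
  let ?ws = "affordable u v (fiber u v (tneg ?c) ?c (cands ?st)) ?st"
  have len: "length S = 12" using assms(1) by (simp add: admissible_def)
  have st: "known ?st S" using assms(2,3) by (simp add: known_need edge4_def)
  have "{w. third S u v w} \<subseteq> {w \<in> set ?ws. third S u v w}"
    using set_cands[OF st len]
    by (auto intro!: affordable_complete[OF st len] simp: fiber_eq dest: third_fiber)
  then have "card {w. third S u v w} \<le> card {w \<in> set ?ws. third S u v w}"
    by (intro card_mono) auto
  then have "length [(), (), ()] \<le> card {w \<in> set ?ws. third S u v w}"
    using assms(2) by (simp add: edge4_def)
  from isotropic_filter_complete[OF assms(1) pick_complete[OF len st this]]
  show ?thesis
    using room_complete[OF assms(2) st len] by (simp add: supports_def supports'_def)
qed

text \<open>Only the steps after \<open>f 2\<close> are required to be edges.\<close>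

lemma dead_end_sound:
  assumes "admissible S" "known st S" "dead_end n (f 0) (f 1) (f 2) st"
    and "\<And>i. i < n \<Longrightarrow> edge4 S (f (i + 2)) (f (i + 3)) \<and> f (i + 3) \<noteq> f (i + 1) \<and>
            \<not> (f (i + 3) = f i \<and> vadd (f i) (vadd (f (i + 1)) (f (i + 2))) = v0)"
  shows False
  using assms(2-4)
proof (induction n arbitrary: f st)
  case (Suc n)
  have e: "edge4 S (f 2) (f 3)" "f 3 \<noteq> f 1" "\<not> (f 3 = f 0 \<and> vadd (f 0) (vadd (f 1) (f 2)) = v0)"
    using Suc.prems(3)[of 0] by (simp_all add: numeral_2_eq_2 numeral_3_eq_3)
  obtain s where s: "s \<in> set (supports (f 2) (f 3) st)" "known s S"
    using supports_complete[OF assms(1) e(1) Suc.prems(1)] by blast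
  have "f 3 \<in> set (cands st)"
    using set_cands[OF Suc.prems(1)] assms(1) e(1) by (auto simp: admissible_def edge4_def)
  moreover have "\<not> skip (f 0) (f 1) (f 2) (f 3)"
    using e by (auto simp: edge4_def)
  ultimately have dead: "dead_end n (f 1) (f 2) (f 3) s"
    using Suc.prems(2) s(1) by (auto simp: list_all_iff numeral_2_eq_2 numeral_3_eq_3)
  show ?case
  proof (rule Suc.IH[OF s(2), of "\<lambda>i. f (Suc i)"])
    show "dead_end n (f (Suc 0)) (f (Suc 1)) (f (Suc 2)) s"
      using dead by (simp add: numeral_2_eq_2 numeral_3_eq_3)
  next
    fix i assume "i < n"
    then show "edge4 S (f (Suc (i + 2))) (f (Suc (i + 3))) \<and> f (Suc (i + 3)) \<noteq> f (Suc (i + 1)) \<and>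
            \<not> (f (Suc (i + 3)) = f (Suc i) \<and> vadd (f (Suc i)) (vadd (f (Suc (i + 1))) (f (Suc (i + 2)))) = v0)"
      using Suc.prems(3)[of "Suc i"] by simp
  qed
qed simp

text \<open>The result of the search. A walk of six edges starts with the edge \<open>e1, e2\<close>, so it has five
  further edges; \<^term>\<open>v0\<close>, which is not a vertex, stands for the missing vertex before \<^term>\<open>e1\<close>.\<close>

lemma search_zero:
  "list_all (dead_end (Suc (Suc (Suc (Suc (Suc 0))))) v0 e1 e2) (starts v0)"
  by code_simp

lemma search_plus:
  "list_all (dead_end (Suc (Suc (Suc (Suc (Suc 0))))) v0 e1 e2) (starts (vadd e3 e4))"
  by code_simp

lemma search_minus:
  "list_all (dead_end (Suc (Suc (Suc (Suc (Suc 0))))) v0 e1 e2) (starts (vneg (vadd e3 e4)))"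
  by code_simp

lemma search:
  assumes "r \<in> {v0, vadd e3 e4, vneg (vadd e3 e4)}"
  shows "list_all (dead_end 5 v0 e1 e2) (starts r)"
proof -
  have five: "5 = Suc (Suc (Suc (Suc (Suc 0))))" by simp
  show ?thesis unfolding five using assms search_zero search_plus search_minus by blast
qed

text \<open>There is no walk of six edges without backtracking and without triangles of vertex sum zero
  that starts with an edge \<open>e1, e2\<close> in normal position.\<close>

lemma no_walk_from_start:
  fixes f :: "nat \<Rightarrow> vec4"
  assumes "admissible S" and "edge4 S e1 e2" and r: "r \<in> {v0, vadd e3 e4, vneg (vadd e3 e4)}"
    and third: "third S e1 e2 (third_at e3)" "third S e1 e2 (third_at e4)" "third S e1 e2 (third_at r)"
    and f: "f 1 = e1" "f 2 = e2"
    and edge: "\<And>i. i < 5 \<Longrightarrow> edge4 S (f (i + 2)) (f (i + 3))"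
    and nonbacktracking: "\<And>i. i < 5 \<Longrightarrow> f (i + 3) \<noteq> f (i + 1)"
    and no_triangle: "\<And>i. i < 4 \<Longrightarrow>
      \<not> (f (i + 4) = f (i + 1) \<and> vadd (f (i + 1)) (vadd (f (i + 2)) (f (i + 3))) = v0)"
  shows False
proof -
  have len: "length S = 12" using assms(1) by (simp add: admissible_def)
  have "e1 \<noteq> e2" by (simp add: e1_def e2_def)
  then have known: "known [e1, e2] S"
    using assms(2) known_need[of "[]" S e2] known_need[of "[e2]" S e1]
    by (simp add: edge4_def need_def known_def)
  have "distinct [third_at e3, third_at e4, third_at r]"
    using r by (auto simp: third_at_def e1_def e2_def e3_def e4_def v0_def)
  moreover have "{w \<in> set [third_at e3, third_at e4, third_at r]. third S e1 e2 w}
      = set [third_at e3, third_at e4, third_at r]"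
    using third by auto
  ultimately have "length [(), (), ()] \<le>
      card {w \<in> set [third_at e3, third_at e4, third_at r]. third S e1 e2 w}"
    using distinct_card[of "[third_at e3, third_at e4, third_at r]"] by (simp del: set_simps)
  from isotropic_filter_complete[OF assms(1) pick_complete[OF len known this]]
  obtain s where s: "s \<in> set (starts r)" "known s S" by (auto simp: starts_def)
  have dead: "dead_end 5 v0 e1 e2 s" using search[OF r] s(1) by (simp add: list_all_iff)
  define g where "g = (\<lambda>i. if i = 0 then v0 else f i)"
  show False
  proof (rule dead_end_sound[OF assms(1) s(2), of 5 g])
    show "dead_end 5 (g 0) (g 1) (g 2) s"
    proof -
      have "g 0 = v0" "g 1 = e1" "g 2 = e2" using f by (simp_all add: g_def)
      then show ?thesis using dead by (simp only:)
    qed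
  next
    fix i :: nat assume i: "i < 5"
    have "g (i + 3) \<noteq> v0" using edge[OF i] assms(1) by (auto simp: g_def edge4_def admissible_def)
    moreover have "\<not> (g (i + 3) = g i \<and> vadd (g i) (vadd (g (i + 1)) (g (i + 2))) = v0)" if "i > 0"
    proof -
      have "g k = f k" if "k > 0" for k using that by (simp add: g_def)
      moreover have "i - 1 + 1 = i" "i - 1 + 2 = i + 1" "i - 1 + 3 = i + 2" "i - 1 + 4 = i + 3" "i - 1 < 4"
        using i that by linarith+
      ultimately show ?thesis using no_triangle[of "i - 1"] that by (simp add: add.commute)
    qed
    ultimately show "edge4 S (g (i + 2)) (g (i + 3)) \<and> g (i + 3) \<noteq> g (i + 1) \<and>
            \<not> (g (i + 3) = g i \<and> vadd (g i) (vadd (g (i + 1)) (g (i + 2))) = v0)"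
      using edge[OF i] nonbacktracking[OF i] by (cases "i = 0") (auto simp: g_def)
  qed
qed

section \<open>Symplectic geometry over the field with three elements\<close>

text \<open>A nondegenerate alternating form on the four-dimensional space, and a sequence of twelve nonzero
  vectors with at most three terms in every isotropic plane.\<close>

locale symplectic_sequence =
  fixes \<omega> :: "'k::field ^ 4 \<Rightarrow> 'k ^ 4 \<Rightarrow> 'k" and S :: "('k ^ 4) list"
  assumes card_field: "CARD('k) = 3"
    and alternating: "alternating_form \<omega>" and nondegenerate: "nondegenerate_on \<omega> UNIV"
    and length_S: "length S = 12" and zero_notin_S: "0 \<notin> set S"
    and isotropic_planes: "\<And>U. subspace_of_dim 2 U \<Longrightarrow> isotropic \<omega> U \<Longrightarrow> terms_in S U \<le> 3"
begin

lemma scalar_cases: "(a::'k) = 0 \<or> a = 1 \<or> a = - 1"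
  and three_eq_0: "(3::'k) = 0"
  and one_neq_minus_one: "(1::'k) \<noteq> - 1"
proof -
  have fin: "finite (UNIV :: 'k set)" using card_field card_ge_0_finite[of "UNIV :: 'k set"] by simp
  have "{0, 1::'k} \<noteq> UNIV"
  proof
    assume "{0, 1::'k} = UNIV"
    then have "CARD('k) = card {0, 1::'k}" by simp
    then show False using card_field by simp
  qed
  then obtain z :: 'k where z: "z \<noteq> 0" "z \<noteq> 1" by auto
  have "{0, 1, z} = UNIV"
    by (rule card_subset_eq[OF fin]) (use z card_field in auto)
  then have UNIV: "a = 0 \<or> a = 1 \<or> a = z" for a by blast
  have minus: "z = - 1" using UNIV[of "z + 1"] z by (auto simp: eq_neg_iff_add_eq_0)
  then show "a = 0 \<or> a = 1 \<or> a = - 1" using UNIV by blast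
  show ne: "(1::'k) \<noteq> - 1" using z minus by simp
  have "(1::'k) + 1 \<noteq> 0" using ne unfolding eq_neg_iff_add_eq_0 .
  moreover have "(1::'k) + 1 \<noteq> 1" by (metis add_left_cancel add.right_neutral zero_neq_one)
  ultimately have two: "(1::'k) + 1 = - 1" using UNIV[of "1 + 1"] minus by blast
  have "(3::'k) = 1 + 1 + 1" by simp
  also have "\<dots> = 0" unfolding two by simp
  finally show "(3::'k) = 0" .
qed

lemma two_eq_minus_one: "(2::'k) = - 1"
proof -
  have "(2::'k) = 3 - 1" by simp
  then show ?thesis unfolding three_eq_0 by simp
qed

lemma form_add_right [simp]: "\<omega> x (y + z) = \<omega> x y + \<omega> x z"
  and form_scale_right [simp]: "\<omega> x (a *s y) = a * \<omega> x y"
  and form_add_left [simp]: "\<omega> (x + y) z = \<omega> x z + \<omega> y z"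
  and form_scale_left [simp]: "\<omega> (a *s x) z = a * \<omega> x z"
  and form_self [simp]: "\<omega> x x = 0"
proof -
  have r: "module_hom (*s) (*) (\<lambda>y. \<omega> x y)" and l: "module_hom (*s) (*) (\<lambda>y. \<omega> y z)" for x z
    using alternating unfolding alternating_form_def by (auto simp: Vector_Spaces.linear_def)
  show "\<omega> x (y + z) = \<omega> x y + \<omega> x z" "\<omega> x (a *s y) = a * \<omega> x y"
    using module_hom.add[OF r] module_hom.scale[OF r] by auto
  show "\<omega> (x + y) z = \<omega> x z + \<omega> y z" "\<omega> (a *s x) z = a * \<omega> x z"
    using module_hom.add[OF l] module_hom.scale[OF l] by auto
  show "\<omega> x x = 0" using alternating by (simp add: alternating_form_def)
qed

lemma form_zero [simp]: "\<omega> x 0 = 0" "\<omega> 0 x = 0"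
  using form_scale_right[of x 0 0] form_scale_left[of 0 0 x] by simp_all

lemma form_minus [simp]: "\<omega> x (- y) = - \<omega> x y" "\<omega> (- x) y = - \<omega> x y"
  using form_scale_right[of x "- 1" y] form_scale_left[of "- 1" x y] by simp_all

lemma form_diff [simp]: "\<omega> x (y - z) = \<omega> x y - \<omega> x z" "\<omega> (x - y) z = \<omega> x z - \<omega> y z"
  using form_add_right[of x y "- z"] form_add_left[of x "- y" z] by simp_all

lemma form_swap: "\<omega> y x = - \<omega> x y"
proof -
  have "0 = \<omega> (x + y) (x + y)" by (rule form_self[symmetric])
  also have "\<dots> = \<omega> y x + \<omega> x y" unfolding form_add_left form_add_right by simp
  finally show ?thesis unfolding eq_neg_iff_add_eq_0 by (rule sym)
qed

lemma radical: "(\<And>y. \<omega> x y = 0) \<Longrightarrow> x = 0"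
  using nondegenerate unfolding nondegenerate_on_def by blast

text \<open>An isotropic plane is its own orthogonal complement.\<close>

lemma perp_isotropic_plane:
  assumes "x \<noteq> 0" "y \<notin> vec.span {x}" "\<omega> x y = 0" "\<omega> x z = 0" "\<omega> y z = 0"
  shows "z \<in> vec.span {x, y}"
proof (rule ccontr)
  assume z: "z \<notin> vec.span {x, y}"
  have "vec.independent {y, x}" using assms(1,2) vec.independent_insertI[of y "{x}"] by simp
  then have ind: "vec.independent {z, y, x}"
    using z vec.independent_insertI[of z "{y, x}"] by (simp add: insert_commute)
  define B where "B = vec.extend_basis {z, y, x}"
  have B: "{z, y, x} \<subseteq> B" "vec.independent B" "vec.span B = UNIV"
    using vec.extend_basis_superset[OF ind] vec.independent_extend_basis[OF ind]
      vec.span_extend_basis[OF ind] by (auto simp: B_def)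
  have "card B = 4"
    using vec.dim_eq_card[OF _ B(2), of UNIV] B(3) by (simp add: card_cart_basis)
  have dist: "x \<noteq> y" "z \<noteq> x" "z \<noteq> y"
    using assms(2) z by (auto simp: vec.span_base)
  have "finite B" using \<open>card B = 4\<close> card_ge_0_finite by force
  have "card (B - {z, y, x}) = 1"
    using \<open>card B = 4\<close> B(1) dist by (subst card_Diff_subset) auto
  then obtain w where "B - {z, y, x} = {w}" by (auto simp: card_1_singleton_iff)
  then have Bw: "B = {w, z, y, x}" using B(1) by auto
  have 0: "s = 0" if "\<omega> s w = 0" "\<omega> s z = 0" "\<omega> s y = 0" "\<omega> s x = 0" for s
  proof (rule radical)
    fix v
    have "v \<in> vec.span B" using B(3) by simp
    then show "\<omega> s v = 0"
      by (induction rule: vec.span_induct_alt) (use that Bw in auto)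
  qed
  define s where "s = \<omega> y w *s x - \<omega> x w *s y"
  have "s = 0"
    using 0[of s] assms form_swap[of x y] by (simp add: s_def)
  then have "\<omega> x w *s y = \<omega> y w *s x" by (simp add: s_def)
  then have "\<omega> x w *s y \<in> vec.span {x}" by (simp add: vec.span_scale vec.span_base)
  have "\<omega> x w = 0"
  proof (rule ccontr)
    assume "\<omega> x w \<noteq> 0"
    then have "y = inverse (\<omega> x w) *s (\<omega> x w *s y)" by simp
    then show False using assms(2) \<open>\<omega> x w *s y \<in> vec.span {x}\<close> vec.span_scale by metis
  qed
  then have "x = 0" using 0[of x] assms by simp
  then show False using assms(1) by simp
qed

lemma isotropic_plane_bound:
  assumes "x \<noteq> 0" "y \<notin> vec.span {x}" "\<omega> x y = 0"
  shows "length (filter (\<lambda>z. z \<in> vec.span {x, y}) S) \<le> 3"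
proof -
  have ind: "vec.independent {y, x}" using assms(1,2) vec.independent_insertI[of y "{x}"] by simp
  have "x \<noteq> y" using assms(2) by (auto simp: vec.span_base)
  then have "vec.dim (vec.span {x, y}) = 2"
    using vec.dim_eq_card_independent[OF ind] by (simp add: insert_commute vec.dim_span)
  then have dim: "subspace_of_dim 2 (vec.span {x, y})"
    by (simp add: subspace_of_dim_def)
  have 1: "\<omega> a p = 0" if "p \<in> vec.span {x, y}" "a \<in> {x, y}" for a p
    using that(1) by (induction rule: vec.span_induct_alt) (use that(2) assms(3) form_swap[of x y] in auto)
  have "\<omega> q p = 0" if "p \<in> vec.span {x, y}" "q \<in> vec.span {x, y}" for p q
    using that(2) by (induction rule: vec.span_induct_alt) (use 1[OF that(1)] in auto)
  then have "isotropic \<omega> (vec.span {x, y})" by (auto simp: isotropic_def)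
  from isotropic_planes[OF dim this] show ?thesis by (simp add: terms_in_def)
qed

end

section \<open>Coordinates adapted to an edge\<close>

text \<open>Scalars and vectors from coordinates.\<close>

fun of_trit :: "trit \<Rightarrow> 'k::field" where
  "of_trit T0 = 0"
| "of_trit T1 = 1"
| "of_trit T2 = - 1"

fun combination :: "'k::field ^ 4 \<Rightarrow> 'k ^ 4 \<Rightarrow> 'k ^ 4 \<Rightarrow> 'k ^ 4 \<Rightarrow> vec4 \<Rightarrow> 'k ^ 4" where
  "combination u v a b (V p q s t) = of_trit p *s u + of_trit q *s v + of_trit s *s a + of_trit t *s b"

context symplectic_sequence
begin

lemma of_trit_add: "of_trit (tadd a b) = of_trit a + (of_trit b :: 'k)"
  using two_eq_minus_one by (cases a; cases b) (simp_all add: minus_equation_iff)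

lemma of_trit_neg: "of_trit (tneg a) = - (of_trit a :: 'k)"
  by (cases a) simp_all

lemma of_trit_mul: "of_trit (tmul a b) = of_trit a * (of_trit b :: 'k)"
  by (cases a; cases b) simp_all

lemma of_trit_inject [simp]: "of_trit a = (of_trit b :: 'k) \<longleftrightarrow> a = b"
  using one_neq_minus_one one_neq_minus_one[symmetric] by (cases a; cases b) simp_all

lemma of_trit_eq_0 [simp]: "of_trit a = (0 :: 'k) \<longleftrightarrow> a = T0"
  by (cases a) simp_all

lemma combination_vadd: "combination u v a b (vadd x y) = combination u v a b x + combination u v a b (y :: vec4) "
  for u v a b :: "'k ^ 4"
  by (cases x; cases y) (simp add: of_trit_add vec.scale_left_distrib)

lemma combination_vneg: "combination u v a b (vneg x) = - combination u v a b x" for u v a b :: "'k ^ 4"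
  by (cases x) (simp add: of_trit_neg)

lemma combination_bij:
  assumes "\<omega> u v \<noteq> 0" "\<omega> u a = 0" "\<omega> v a = 0" "\<omega> u b = 0" "\<omega> v b = 0"
    and "a \<noteq> 0" "b \<noteq> 0" "a \<noteq> b" "a \<noteq> - b"
  shows "bij (combination u v a b)"
proof -
  have ker: "x = v0" if "combination u v a b x = 0" for x
  proof -
    obtain p q s t where x: "x = V p q s t" by (cases x)
    have "\<omega> u (combination u v a b x) = 0" "\<omega> v (combination u v a b x) = 0"
      using that by simp_all
    then have pq: "p = T0" "q = T0"
      using assms form_swap[of v u] by (simp_all add: x)
    then have "of_trit s *s a + of_trit t *s b = 0" using that by (simp add: x)
    moreover have "a + b \<noteq> 0" "a - b \<noteq> 0" "- a + b \<noteq> 0" "- a - b \<noteq> 0"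
    proof -
      show "a + b \<noteq> 0" using assms(9) by (simp add: eq_neg_iff_add_eq_0)
      then have "- (a + b) \<noteq> 0" by (simp only: neg_equal_0_iff_equal) simp
      then show "- a - b \<noteq> 0" by simp
      show "a - b \<noteq> 0" "- a + b \<noteq> 0" using assms(8) by simp_all
    qed
    ultimately have "s = T0 \<and> t = T0"
      using assms(6,7) by (cases s; cases t) simp_all
    then show ?thesis using pq by (simp add: x v0_def)
  qed
  have inj: "inj (combination u v a b)"
  proof (rule injI)
    fix x y assume "combination u v a b x = combination u v a b y"
    then have "combination u v a b (vadd x (vneg y)) = 0"
      by (simp add: combination_vadd combination_vneg)
    then have "vadd x (vneg y) = vadd x (vneg x)"
      using ker[of "vadd x (vneg y)"] by (cases x) (simp add: v0_def)
    then show "x = y" by simp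
  qed
  \<comment> \<open>Both spaces have 81 elements.\<close>
  have "card (set vecs) = CARD('k ^ 4)"
  proof -
    have "distinct vecs" by code_simp
    moreover have "length vecs = 81" by code_simp
    ultimately show ?thesis using card_field by (simp add: distinct_card del: set_vecs)
  qed
  then have "card (range (combination u v a b)) = CARD('k ^ 4)"
    using inj by (simp add: card_image)
  moreover have "finite (UNIV :: ('k ^ 4) set)"
    using card_field card_ge_0_finite[of "UNIV :: ('k ^ 4) set"] by simp
  ultimately have "range (combination u v a b) = UNIV"
    by (metis card_subset_eq subset_UNIV)
  then show ?thesis using inj by (simp add: bij_def)
qed

lemma combination_form:
  assumes "\<omega> u v = c" "\<omega> a b = c" "\<omega> u a = 0" "\<omega> v a = 0" "\<omega> u b = 0" "\<omega> v b = 0"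
  shows "\<omega> (combination u v a b x) (combination u v a b y) = c * of_trit (om x y)"
proof -
  have "\<omega> v u = - c" "\<omega> b a = - c" "\<omega> a u = 0" "\<omega> a v = 0" "\<omega> b u = 0" "\<omega> b v = 0"
    using assms form_swap[of v u] form_swap[of b a] form_swap[of a u] form_swap[of a v]
      form_swap[of b u] form_swap[of b v] by simp_all
  then show ?thesis
    using assms by (cases x; cases y) (simp add: of_trit_add of_trit_neg of_trit_mul algebra_simps)
qed

text \<open>The triple \<open>{u, v, w}\<close> belongs to the family, where \<open>u, v\<close> are terms with \<open>\<omega> u v \<noteq> 0\<close>.\<close>

definition closing :: "'k ^ 4 \<Rightarrow> 'k ^ 4 \<Rightarrow> 'k ^ 4 \<Rightarrow> bool" where
  "closing u v w \<longleftrightarrow> w \<in> set S \<and> \<omega> v w = \<omega> u v \<and> \<omega> w u = \<omega> u v \<and>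
     (let t = u + v + w in t = 0 \<or> - t \<in> set S \<or> count_list S t \<ge> 2)"

text \<open>The edge relation of the graph, with the triples counted by their third vertices.\<close>

definition adjacent :: "'k ^ 4 \<Rightarrow> 'k ^ 4 \<Rightarrow> bool" where
  "adjacent u v \<longleftrightarrow> u \<in> set S \<and> v \<in> set S \<and> \<omega> u v \<noteq> 0 \<and> card {w. closing u v w} \<ge> 3"

text \<open>A similitude from the coordinate space; the multiplier \<open>c\<close> allows for both values of the form
  on an edge.\<close>

definition similitude :: "(vec4 \<Rightarrow> 'k ^ 4) \<Rightarrow> 'k \<Rightarrow> bool" where
  "similitude \<phi> c \<longleftrightarrow> bij \<phi> \<and> c \<noteq> 0 \<and> (\<forall>x y. \<phi> (vadd x y) = \<phi> x + \<phi> y) \<and>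
     (\<forall>x. \<phi> (vneg x) = - \<phi> x) \<and> \<phi> v0 = 0 \<and> (\<forall>x y. \<omega> (\<phi> x) (\<phi> y) = c * of_trit (om x y))"

context
  fixes \<phi> c
  assumes sim: "similitude \<phi> c"
begin

text \<open>The sequence in coordinates.\<close>

definition S' :: "vec4 list" where "S' = map (inv \<phi>) S"

lemma phi_inj [simp]: "\<phi> x = \<phi> y \<longleftrightarrow> x = y"
  using sim by (auto simp: similitude_def bij_def inj_def)

lemma phi_inv [simp]: "\<phi> (inv \<phi> x) = x" "inv \<phi> (\<phi> y) = y"
  using sim by (auto simp: similitude_def bij_inv_eq_iff bij_is_inj surj_f_inv_f bij_is_surj)

lemma phi_hom: "\<phi> (vadd x y) = \<phi> x + \<phi> y" "\<phi> (vneg x) = - \<phi> x" "\<phi> v0 = 0" and c: "c \<noteq> 0"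
  and phi_form: "\<omega> (\<phi> x) (\<phi> y) = c * of_trit (om x y)"
  using sim by (auto simp: similitude_def)

lemma S_eq: "S = map \<phi> S'"
  by (simp add: S'_def comp_def)

lemma mem_S' [simp]: "\<phi> x \<in> set S \<longleftrightarrow> x \<in> set S'"
  by (subst S_eq) auto

lemma count_S' [simp]: "count_list S (\<phi> x) = count_list S' x"
proof -
  have "count_list (map \<phi> l) (\<phi> x) = count_list l x" for l by (induction l) auto
  then show ?thesis using S_eq by metis
qed

lemma third_iff: "third S' u v w \<longleftrightarrow> closing (\<phi> u) (\<phi> v) (\<phi> w)"
proof -
  have eq: "\<phi> u + \<phi> v + \<phi> w = \<phi> (vadd u (vadd v w))" by (simp add: phi_hom add.assoc)
  have "\<phi> t = 0 \<longleftrightarrow> t = v0" for t using phi_inj[of t v0] by (simp add: phi_hom del: phi_inj)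
  then show ?thesis
    using c unfolding closing_def third_def eq phi_hom(2)[symmetric] Let_def
    by (simp add: phi_form)
qed

lemma edge4_iff: "edge4 S' u v \<longleftrightarrow> adjacent (\<phi> u) (\<phi> v)"
proof -
  have "{w. closing (\<phi> u) (\<phi> v) w} = \<phi> ` {w. third S' u v w}"
    by (auto simp: third_iff image_iff) (metis phi_inv(1))
  moreover have "card (\<phi> ` {w. third S' u v w}) = card {w. third S' u v w}"
    by (rule card_image) (simp add: inj_on_def)
  ultimately show ?thesis
    using c by (simp add: adjacent_def edge4_def phi_form)
qed

lemma admissible_S': "admissible S'"
  unfolding admissible_def
proof (intro conjI ballI impI)
  show "length S' = 12" using length_S by (simp add: S'_def)
  show v0: "v0 \<notin> set S'" using zero_notin_S mem_S'[of v0] by (simp add: phi_hom del: mem_S')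
  fix x y assume xy: "x \<in> set S'" "y \<in> set S'" "om x y = T0" "y \<noteq> x" "y \<noteq> vneg x"
  have nz: "\<phi> x \<noteq> 0" "\<phi> y \<noteq> 0" using xy v0 phi_inj[of _ v0] by (auto simp: phi_hom simp del: phi_inj)
  have "\<phi> y \<notin> vec.span {\<phi> x}"
  proof
    assume "\<phi> y \<in> vec.span {\<phi> x}"
    then obtain k where k: "\<phi> y = k *s \<phi> x" by (auto simp: vec.span_singleton)
    show False
      using scalar_cases[of k] k nz xy(4,5) phi_inj[of y "vneg x"]
      by (auto simp: phi_hom simp del: phi_inj) (simp add: phi_inj)
  qed
  moreover have "\<omega> (\<phi> x) (\<phi> y) = 0" using xy by (simp add: phi_form)
  ultimately have 3: "length (filter (\<lambda>z. z \<in> vec.span {\<phi> x, \<phi> y}) S) \<le> 3"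
    and span: "\<And>z. \<omega> (\<phi> x) z = 0 \<Longrightarrow> \<omega> (\<phi> y) z = 0 \<Longrightarrow> z \<in> vec.span {\<phi> x, \<phi> y}"
    using isotropic_plane_bound perp_isotropic_plane nz(1) by blast+
  have "length (filter (\<lambda>z. om x z = T0 \<and> om y z = T0) S')
      = length (filter (\<lambda>z. \<omega> (\<phi> x) z = 0 \<and> \<omega> (\<phi> y) z = 0) S)"
    using c by (subst S_eq) (simp add: filter_map comp_def phi_form)
  also have "\<dots> = length (filter (\<lambda>z. \<omega> (\<phi> x) z = 0 \<and> \<omega> (\<phi> y) z = 0)
                    (filter (\<lambda>z. z \<in> vec.span {\<phi> x, \<phi> y}) S))"
    unfolding filter_filter
    by (intro arg_cong[where f = length] filter_cong refl) (use span in blast)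
  also have "\<dots> \<le> length (filter (\<lambda>z. z \<in> vec.span {\<phi> x, \<phi> y}) S)"
    by (rule length_filter_le)
  finally show "length (filter (\<lambda>z. om x z = T0 \<and> om y z = T0) S') \<le> 3" using 3 by simp
qed

end
end

lemma four_le_length_filter:
  assumes "w \<in> set S" "w' \<in> set S" "p \<in> set S" "q \<in> set S" "P w" "P w'" "P p" "P q"
    and "w \<noteq> w'" "p \<noteq> w" "p \<noteq> w'" "q \<noteq> w" "q \<noteq> w'" and "p \<noteq> q \<or> count_list S p \<ge> 2"
  shows "length (filter P S) \<ge> 4"
proof (cases "p = q")
  case False
  have "{w, w', p, q} \<subseteq> set (filter P S)" using assms by auto
  then have "card {w, w', p, q} \<le> card (set (filter P S))" by (intro card_mono) auto
  moreover have "card {w, w', p, q} = 4" using assms False by auto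
  ultimately show ?thesis using card_length[of "filter P S"] by linarith
next
  case True
  then have "count_list S p \<ge> 2" using assms by blast
  moreover have "length (filter (\<lambda>x. p = x) (filter P S)) = count_list S p"
    using \<open>P p\<close> by (auto simp: count_list_eq_length_filter intro!: arg_cong[of _ _ length] filter_cong)
  moreover have "{w, w'} \<subseteq> set (filter (\<lambda>x. p \<noteq> x) (filter P S))" using assms by auto
  then have "card {w, w'} \<le> card (set (filter (\<lambda>x. p \<noteq> x) (filter P S)))" by (intro card_mono) auto
  then have "2 \<le> length (filter (\<lambda>x. p \<noteq> x) (filter P S))"
    using card_length[of "filter (\<lambda>x. p \<noteq> x) (filter P S)"] assms(9) by simp
  ultimately show ?thesis using sum_length_filter_compl[of "\<lambda>x. p = x" "filter P S"] by linarith
qed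

context symplectic_sequence
begin

lemma closing_sum_perp:
  assumes "closing u v w"
  shows "\<omega> u (u + v + w) = 0 \<and> \<omega> v (u + v + w) = 0"
proof -
  have w: "\<omega> v w = \<omega> u v" "\<omega> w u = \<omega> u v" using assms by (simp_all add: closing_def)
  have "\<omega> u w = - \<omega> u v" unfolding form_swap[of u w] w ..
  moreover have "\<omega> v u = - \<omega> u v" by (rule form_swap)
  ultimately show ?thesis using w(1) by simp
qed

text \<open>The isotropic plane spanned by \<open>t\<close> and \<open>u + v\<close> would contain two third vertices and two
  witnesses.\<close>

lemma closing_not_opposite:
  assumes c: "\<omega> u v \<noteq> 0" and w: "closing u v w" and w': "closing u v w'"
    and t: "u + v + w = t" and t': "u + v + w' = - t" and nz: "t \<noteq> 0"
  shows False
proof -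
  let ?U = "vec.span {t, u + v}"
  have perp: "\<omega> u t = 0" "\<omega> v t = 0" using closing_sum_perp[OF w] by (simp_all add: t)
  then have perp': "\<omega> t u = 0" "\<omega> t v = 0" using form_swap[of t u] form_swap[of t v] by simp_all
  have "u + v \<notin> vec.span {t}"
  proof
    assume "u + v \<in> vec.span {t}"
    then obtain k where "u + v = k *s t" by (auto simp: vec.span_singleton)
    then have "\<omega> u (u + v) = \<omega> u (k *s t)" by simp
    then show False using c perp by simp
  qed
  then have le: "length (filter (\<lambda>z. z \<in> ?U) S) \<le> 3"
    using isotropic_plane_bound[OF nz] perp' by simp
  have U: "t \<in> ?U" "- t \<in> ?U" "u + v \<in> ?U" by (simp_all add: vec.span_base vec.span_neg)
  have weq: "w = t - (u + v)" "w' = - t - (u + v)" using t t' by (simp_all add: algebra_simps)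
  then have wU: "w \<in> ?U" "w' \<in> ?U" using U vec.span_diff by blast+
  have "t \<noteq> - t"
  proof
    assume "t = - t"
    then have "2 *s t = 0" by (metis one_add_one vec.scale_left_distrib vec.scale_one add.right_inverse)
    then show False using nz two_eq_minus_one by simp
  qed
  then have "w \<noteq> w'" by (simp add: weq)
  have "\<omega> u w = - \<omega> u v" "\<omega> u w' = - \<omega> u v" using perp by (simp_all add: weq)
  then have ne: "x \<noteq> w" "x \<noteq> w'" if "x = t \<or> x = - t" for x
    using that c perp by auto
  have S: "w \<in> set S" "w' \<in> set S"
    and wit: "- t \<in> set S \<or> count_list S t \<ge> 2" "t \<in> set S \<or> count_list S (- t) \<ge> 2"
    using w w' nz by (simp_all add: closing_def t t' Let_def)
  have mem: "x \<in> set S" if "count_list S x \<ge> 2" for x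
    using that by (metis count_notin not_numeral_le_zero)
  have "\<exists>p q. p \<in> set S \<and> q \<in> set S \<and> (p = t \<or> p = - t) \<and> (q = t \<or> q = - t) \<and>
      (p \<noteq> q \<or> count_list S p \<ge> 2)"
    using wit mem \<open>t \<noteq> - t\<close> by metis
  then obtain p q where "p \<in> set S" "q \<in> set S" "p = t \<or> p = - t" "q = t \<or> q = - t"
      "p \<noteq> q \<or> count_list S p \<ge> 2" by blast
  then have "length (filter (\<lambda>z. z \<in> ?U) S) \<ge> 4"
    using four_le_length_filter[of w S w' p q "\<lambda>z. z \<in> ?U"] S wU U ne \<open>w \<noteq> w'\<close> by metis
  then show False using le by simp
qed

lemma combination_e [simp]:
  "combination u v a b e1 = u" "combination u v a b e2 = v"
  "combination u v a b e3 = a" "combination u v a b e4 = (b :: 'k ^ 4)"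
  "combination u v a b v0 = 0"
  unfolding e1_def e2_def e3_def e4_def v0_def combination.simps of_trit.simps
  by simp_all

text \<open>Up to a choice of symplectic basis \<open>a, b\<close> of \<open>\<langle>u, v\<rangle>\<^sup>\<bottom>\<close>, there are three possibilities for
  three of the sums of an edge.\<close>

lemma three_sums_normal_form:
  assumes c: "\<omega> u v \<noteq> 0" and perp: "\<And>t. t \<in> T \<Longrightarrow> \<omega> u t = 0 \<and> \<omega> v t = 0"
    and no_opposite: "\<And>t. t \<in> T \<Longrightarrow> - t \<in> T \<Longrightarrow> t = 0"
    and T: "x \<in> T" "y \<in> T" "z \<in> T" and dist: "x \<noteq> 0" "y \<noteq> 0" "x \<noteq> y" "z \<noteq> x" "z \<noteq> y"
  shows "\<exists>a b r. a \<in> T \<and> b \<in> T \<and> r \<in> T \<and> a \<noteq> 0 \<and> b \<noteq> 0 \<and> a \<noteq> b \<and> \<omega> a b = \<omega> u v \<and>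
           (r = 0 \<or> r = a + b \<or> r = - (a + b))"
proof -
  have opp: "s \<noteq> - t" if "s \<in> T" "t \<in> T" "t \<noteq> 0" for s t
    using no_opposite[of t] that by auto
  have bij: "bij (combination u v x y)"
    using combination_bij[OF c, of x y] perp[OF T(1)] perp[OF T(2)] dist opp[OF T(1,2) dist(2)]
    by simp
  have "\<omega> x y \<noteq> 0"
  proof
    assume xy: "\<omega> x y = 0"
    have "x = 0"
    proof (rule radical)
      fix p
      obtain q where q: "p = combination u v x y q" using bij_is_surj[OF bij] by (metis surjD)
      have "\<omega> x u = 0" "\<omega> x v = 0" using perp[OF T(1)] form_swap[of x u] form_swap[of x v] by simp_all
      then show "\<omega> x p = 0" unfolding q using xy by (cases q) simp
    qed
    then show False using dist by simp
  qed
  then have sign: "\<omega> x y = \<omega> u v \<or> \<omega> y x = \<omega> u v"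
    using scalar_cases[of "\<omega> x y"] scalar_cases[of "\<omega> u v"] c form_swap[of y x] by auto
  obtain q where q: "z = combination u v x y q" using bij_is_surj[OF bij] by (metis surjD)
  obtain k l m n where klmn: "q = V k l m n" by (cases q)
  have "k = T0" "l = T0"
    using perp[OF T(3)] perp[OF T(1)] perp[OF T(2)] c form_swap[of v u] unfolding q klmn by simp_all
  then have z: "z = of_trit m *s x + of_trit n *s y" unfolding q klmn by simp
  have z_cases: "z = 0 \<or> z = x + y \<or> z = - (x + y) \<or> z = x - y \<or> z = y - x"
    using dist opp[OF T(3) T(1) dist(1)] opp[OF T(3) T(2) dist(2)] unfolding z
    by (cases m; cases n) simp_all
  have *: ?thesis if xy: "\<omega> a b = \<omega> u v" "a \<in> T" "b \<in> T" "a \<noteq> 0" "b \<noteq> 0" "a \<noteq> b" "z \<noteq> a" "z \<noteq> b"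
      and z: "z = 0 \<or> z = a + b \<or> z = - (a + b) \<or> z = a - b \<or> z = b - a" for a b
  proof -
    consider "z = 0 \<or> z = a + b \<or> z = - (a + b)" | "z = a - b" | "z = b - a" using z by blast
    then show ?thesis
    proof cases
      case 1
      then show ?thesis using that T(3) by blast
    next
      case 2
      have "z \<noteq> 0" "\<omega> z b = \<omega> u v" "a = z + b" using xy by (simp_all add: 2)
      then show ?thesis using xy T(3) by blast
    next
      case 3
      have "z \<noteq> 0" "\<omega> a z = \<omega> u v" "b = a + z" using xy by (simp_all add: 3)
      then show ?thesis using xy T(3) by metis
    qed
  qed
  have z_cases': "z = 0 \<or> z = y + x \<or> z = - (y + x) \<or> z = y - x \<or> z = x - y"
    using z_cases by (auto simp: add.commute)
  show ?thesis
    using sign *[OF _ T(1,2) dist(1,2,3,4,5) z_cases]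
      *[OF _ T(2,1) dist(2,1) dist(3)[symmetric] dist(5,4) z_cases'] by (elim disjE)
qed

text \<open>Every edge can be moved to \<open>e1, e2\<close>, with three of its sums in normal form.\<close>

lemma edge_normal_form:
  assumes "adjacent u v"
  obtains \<phi> c r where "similitude \<phi> c" "\<phi> e1 = u" "\<phi> e2 = v" "r \<in> {v0, vadd e3 e4, vneg (vadd e3 e4)}"
    "third (S' \<phi>) e1 e2 (third_at e3)" "third (S' \<phi>) e1 e2 (third_at e4)"
    "third (S' \<phi>) e1 e2 (third_at r)"
proof -
  have c: "\<omega> u v \<noteq> 0" and "card {w. closing u v w} \<ge> 3" using assms by (auto simp: adjacent_def)
  then obtain W where W: "W \<subseteq> {w. closing u v w}" "card W = 3"
    by (meson obtain_subset_with_card_n)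
  then obtain w1 w2 w3 where w: "W = {w1, w2, w3}" "w1 \<noteq> w2" "w1 \<noteq> w3" "w2 \<noteq> w3"
    by (auto simp: card_3_iff)
  define T where "T = {t. closing u v (t - (u + v))}"
  have T: "u + v + w1 \<in> T" "u + v + w2 \<in> T" "u + v + w3 \<in> T" using W(1) by (auto simp: T_def w)
  have perp: "\<omega> u t = 0 \<and> \<omega> v t = 0" if "t \<in> T" for t
    using that closing_sum_perp[of u v "t - (u + v)"] by (simp add: T_def)
  have opp: "t = 0" if "t \<in> T" "- t \<in> T" for t
    using that closing_not_opposite[OF c, of "t - (u + v)" "- t - (u + v)" t] by (auto simp: T_def)
  have "\<exists>x y z. x \<in> T \<and> y \<in> T \<and> z \<in> T \<and> x \<noteq> 0 \<and> y \<noteq> 0 \<and> x \<noteq> y \<and> z \<noteq> x \<and> z \<noteq> y"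
  proof -
    let ?x = "u + v + w1" and ?y = "u + v + w2" and ?z = "u + v + w3"
    have d: "?x \<noteq> ?y" "?x \<noteq> ?z" "?y \<noteq> ?z" using w by simp_all
    consider "?x = 0" "?y \<noteq> 0" "?z \<noteq> 0" | "?y = 0" "?x \<noteq> 0" "?z \<noteq> 0" | "?x \<noteq> 0" "?y \<noteq> 0"
      using d by metis
    then show ?thesis
      using T d by cases metis+
  qed
  then obtain x y z where "x \<in> T" "y \<in> T" "z \<in> T" "x \<noteq> 0" "y \<noteq> 0" "x \<noteq> y" "z \<noteq> x" "z \<noteq> y"
    by blast
  from three_sums_normal_form[OF c perp opp this] obtain a b r where
    abr: "a \<in> T" "b \<in> T" "r \<in> T" "a \<noteq> 0" "b \<noteq> 0" "a \<noteq> b" "\<omega> a b = \<omega> u v"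
      "r = 0 \<or> r = a + b \<or> r = - (a + b)" by blast
  have "a \<noteq> - b" using opp[of b] abr by auto
  let ?\<phi> = "combination u v a b"
  have "bij ?\<phi>"
    using combination_bij[OF c, of a b] perp[OF abr(1)] perp[OF abr(2)] abr \<open>a \<noteq> - b\<close> by simp
  moreover have "\<omega> (?\<phi> p) (?\<phi> q) = \<omega> u v * of_trit (om p q)" for p q
    using combination_form[OF refl abr(7), of p q] perp[OF abr(1)] perp[OF abr(2)] by simp
  ultimately have sim: "similitude ?\<phi> (\<omega> u v)"
    using c by (simp add: similitude_def combination_vadd combination_vneg)
  have at: "third (S' ?\<phi>) e1 e2 (third_at s)" if "?\<phi> s \<in> T" for s
    using that third_iff[OF sim, of e1 e2 "third_at s"]
    by (simp add: third_at_def combination_vadd combination_vneg T_def algebra_simps)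
  have "\<exists>r' \<in> {v0, vadd e3 e4, vneg (vadd e3 e4)}. ?\<phi> r' = r"
    using abr(8) by (auto simp: combination_vadd combination_vneg)
  then obtain r' where r': "r' \<in> {v0, vadd e3 e4, vneg (vadd e3 e4)}" "?\<phi> r' = r" by blast
  show ?thesis
    using that[OF sim _ _ r'(1)] at[of e3] at[of e4] at[of r'] abr r'(2) by simp
qed

text \<open>A walk of six edges without backtracking contains a triangle with vertex sum zero.\<close>

lemma no_walk:
  fixes f :: "nat \<Rightarrow> 'k ^ 4"
  assumes edge: "\<And>i. i < 6 \<Longrightarrow> adjacent (f i) (f (i + 1))"
    and nonbacktracking: "\<And>i. i < 5 \<Longrightarrow> f (i + 2) \<noteq> f i"
    and no_triangle: "\<And>i. i < 4 \<Longrightarrow> \<not> (f (i + 3) = f i \<and> f i + f (i + 1) + f (i + 2) = 0)"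
  shows False
proof -
  have "adjacent (f 0) (f 1)" using edge[of 0] by simp
  then obtain \<phi> c r where sim: "similitude \<phi> c" and e: "\<phi> e1 = f 0" "\<phi> e2 = f 1"
    and r: "r \<in> {v0, vadd e3 e4, vneg (vadd e3 e4)}"
    and third: "third (S' \<phi>) e1 e2 (third_at e3)" "third (S' \<phi>) e1 e2 (third_at e4)"
      "third (S' \<phi>) e1 e2 (third_at r)"
    by (rule edge_normal_form)
  define g where "g = (\<lambda>i. inv \<phi> (f (i - 1)))"
  have g: "\<phi> (g i) = f (i - 1)" for i using phi_inv(1)[OF sim] by (simp add: g_def)
  have edge4: "edge4 (S' \<phi>) (g i) (g j) \<longleftrightarrow> adjacent (f (i - 1)) (f (j - 1))" for i j
    using edge4_iff[OF sim] by (simp add: g)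
  have g_eq: "g i = g j \<longleftrightarrow> f (i - 1) = f (j - 1)" for i j
    using phi_inj[OF sim, of "g i" "g j"] by (simp add: g)
  have g12: "g 1 = e1" "g 2 = e2"
    using phi_inj[OF sim, of "g 1" e1] phi_inj[OF sim, of "g 2" e2] g[of 1] g[of 2] e by simp_all
  show False
  proof (rule no_walk_from_start[OF admissible_S'[OF sim] _ r third g12])
    show "edge4 (S' \<phi>) e1 e2" using edge4[of 1 2] edge[of 0] unfolding g12 by simp
    show "edge4 (S' \<phi>) (g (i + 2)) (g (i + 3))" if "i < 5" for i
      using edge4[of "i + 2" "i + 3"] edge[of "i + 1"] that by simp
    show "g (i + 3) \<noteq> g (i + 1)" if "i < 5" for i
      using g_eq[of "i + 3" "i + 1"] nonbacktracking[of i] that by simp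
    show "\<not> (g (i + 4) = g (i + 1) \<and> vadd (g (i + 1)) (vadd (g (i + 2)) (g (i + 3))) = v0)"
      if "i < 4" for i
    proof -
      have "vadd (g (i + 1)) (vadd (g (i + 2)) (g (i + 3))) = v0 \<longleftrightarrow>
          \<phi> (vadd (g (i + 1)) (vadd (g (i + 2)) (g (i + 3)))) = \<phi> v0"
        by (rule phi_inj[OF sim, symmetric])
      also have "\<dots> \<longleftrightarrow> f i + f (i + 1) + f (i + 2) = 0"
        by (simp add: phi_hom[OF sim] g add.assoc)
      finally show ?thesis
        using g_eq[of "i + 4" "i + 1"] no_triangle[OF that] by (simp add: add.commute)
    qed
  qed
qed

end

section \<open>Potentials and closed walks\<close>

text \<open>There is a walk from \<open>u\<close> to \<open>v\<close> along which the cochain \<open>a\<close> sums to \<open>s\<close>.\<close>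

inductive walk_sum :: "('v \<Rightarrow> 'v \<Rightarrow> bool) \<Rightarrow> ('v \<Rightarrow> 'v \<Rightarrow> 'g::ab_group_add) \<Rightarrow> 'v \<Rightarrow> 'v \<Rightarrow> 'g \<Rightarrow> bool"
  for E a where
  nil: "walk_sum E a u u 0"
| snoc: "walk_sum E a u v s \<Longrightarrow> E v w \<Longrightarrow> walk_sum E a u w (s + a v w)"

lemma walk_sum_trans:
  assumes "walk_sum E a v w t" and "walk_sum E a u v s"
  shows "walk_sum E a u w (s + t)"
  using assms
proof (induction arbitrary: s)
  case (snoc v w t x)
  then show ?case using walk_sum.snoc[of E a u w "s + t" x] by (simp add: add.assoc)
qed simp

lemma walk_sum_rev:
  assumes "\<And>u v. E u v \<Longrightarrow> E v u" and anti: "\<And>u v. a v u = - a u v" and "walk_sum E a u v s"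
  shows "walk_sum E a v u (- s)"
  using assms(3)
proof induction
  case (nil u)
  then show ?case using walk_sum.nil[of E a u] by simp
next
  case (snoc u v s w)
  have "walk_sum E a w v (a w v)"
    using walk_sum.snoc[OF walk_sum.nil, of E w v a] assms(1)[OF snoc.hyps(2)] by simp
  moreover have "- (s + a v w) = a w v + - s" using anti[of w v] by simp
  ultimately show ?case using walk_sum_trans[OF snoc.IH] by (simp only:)
qed

lemma walk_sum_fun:
  assumes "walk_sum E a u v s"
  shows "\<exists>f n. f 0 = u \<and> f n = v \<and> (\<forall>i<n. E (f i) (f (Suc i))) \<and> s = (\<Sum>i<n. a (f i) (f (Suc i)))"
  using assms
proof induction
  case (nil u)
  have "(\<lambda>_. u) 0 = u \<and> (\<lambda>_::nat. u) 0 = u" by simp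
  then show ?case by (intro exI[of _ "\<lambda>_. u"] exI[of _ 0]) simp
next
  case (snoc u v s w)
  then obtain f n where f: "f 0 = u" "f n = v" "\<forall>i<n. E (f i) (f (Suc i))"
      "s = (\<Sum>i<n. a (f i) (f (Suc i)))" by blast
  let ?g = "f(Suc n := w)"
  have "(\<Sum>i<n. a (?g i) (?g (Suc i))) = s" unfolding f(4) by (rule sum.cong) auto
  then have "?g 0 = u \<and> ?g (Suc n) = w \<and> (\<forall>i<Suc n. E (?g i) (?g (Suc i))) \<and>
      s + a v w = (\<Sum>i<Suc n. a (?g i) (?g (Suc i)))"
    using f snoc.hyps(2) by (auto simp: less_Suc_eq)
  then show ?case by blast
qed

lemma potential_exists:
  fixes a :: "'v \<Rightarrow> 'v \<Rightarrow> 'g::ab_group_add"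
  assumes sym: "\<And>u v. E u v \<Longrightarrow> E v u" and anti: "\<And>u v. a v u = - a u v"
    and closed: "\<And>(f :: nat \<Rightarrow> 'v) n. f n = f 0 \<Longrightarrow> (\<And>i. i < n \<Longrightarrow> E (f i) (f (Suc i))) \<Longrightarrow>
        (\<Sum>i<n. a (f i) (f (Suc i))) = 0"
  shows "\<exists>p. \<forall>u v. E u v \<longrightarrow> a u v = p v - p u"
proof -
  let ?W = "walk_sum E a"
  have zero: "s = 0" if "?W u u s" for u s
    using walk_sum_fun[OF that] closed by metis
  have unique: "s = t" if "?W u v s" "?W u v t" for u v s t
    using zero[OF walk_sum_trans[OF walk_sum_rev[OF sym anti that(2)] that(1)]] by simp
  define r where "r v = (SOME u. \<exists>s. ?W u v s)" for v
  have r: "\<exists>s. ?W (r v) v s" for v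
    unfolding r_def by (rule someI_ex) (blast intro: walk_sum.nil)
  define p where "p v = (THE s. ?W (r v) v s)" for v
  have p: "?W (r v) v (p v)" for v
    unfolding p_def using r unique by (metis (mono_tags, lifting) theI)
  have "a u v = p v - p u" if "E u v" for u v
  proof -
    have "(\<exists>s. ?W x u s) \<longleftrightarrow> (\<exists>s. ?W x v s)" for x
      using walk_sum.snoc[of E a x u _ v] walk_sum.snoc[of E a x v _ u] that sym by blast
    then have "r u = r v" by (simp add: r_def)
    then have "p v = p u + a u v" using walk_sum.snoc[OF p that] p[of v] unique by metis
    then show ?thesis by simp
  qed
  then show ?thesis by blast
qed

lemma sum_lessThan_add:
  fixes h :: "nat \<Rightarrow> 'g::comm_monoid_add"
  shows "(\<Sum>j<k + l. h j) = (\<Sum>j<k. h j) + (\<Sum>j<l. h (k + j))"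
  by (induction l) (simp_all add: add.assoc)

text \<open>A shortest closed walk with nonzero sum visits no vertex twice: otherwise it splits into two
  shorter closed walks. It is extended periodically here.\<close>

lemma shortest_closed_walk:
  fixes a :: "'v \<Rightarrow> 'v \<Rightarrow> 'g::ab_group_add" and f :: "nat \<Rightarrow> 'v"
  assumes "f n = f 0" "\<And>i. i < n \<Longrightarrow> E (f i) (f (Suc i))" "(\<Sum>i<n. a (f i) (f (Suc i))) \<noteq> 0"
  obtains g m where "\<And>i. g (i + m) = g i" "\<And>i. E (g i) (g (Suc i))"
    "\<And>i. (\<Sum>j<m. a (g (i + j)) (g (Suc (i + j)))) \<noteq> 0"
    "\<And>i k. 0 < k \<Longrightarrow> k < m \<Longrightarrow> g (i + k) \<noteq> g i"
proof -
  define bad where "bad n \<longleftrightarrow> (\<exists>f. f n = f 0 \<and> (\<forall>i<n. E (f i) (f (Suc i))) \<and>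
      (\<Sum>i<n. a (f i) (f (Suc i))) \<noteq> 0)" for n :: nat
  define m where "m = (LEAST n. bad n)"
  have "bad n" using assms unfolding bad_def by blast
  then have "bad m" unfolding m_def by (rule LeastI)
  then obtain h where h: "h m = h 0" "\<forall>i<m. E (h i) (h (Suc i))" "(\<Sum>i<m. a (h i) (h (Suc i))) \<noteq> 0"
    unfolding bad_def by blast
  have m: "m > 0" using h(3) by (cases m) auto
  have least: "(\<Sum>i<k. a (f i) (f (Suc i))) = 0"
    if "k < m" "f k = f 0" "\<And>i. i < k \<Longrightarrow> E (f i) (f (Suc i))" for k and f :: "nat \<Rightarrow> 'v"
  proof -
    have "\<not> bad k" using not_less_Least[of k bad] that(1) by (simp add: m_def)
    then show ?thesis using that(2,3) unfolding bad_def by blast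
  qed
  define g where "g i = h (i mod m)" for i
  have gh: "g i = h i" if "i \<le> m" for i
    using that h(1) m by (cases "i = m") (simp_all add: g_def)
  have period: "g (i + m) = g i" for i by (simp add: g_def)
  have edge: "E (g i) (g (Suc i))" for i
  proof -
    have "g (Suc i) = h (Suc (i mod m))"
      using h(1) m by (cases "Suc (i mod m) = m") (auto simp: g_def mod_Suc)
    then show ?thesis using h(2) m by (simp add: g_def)
  qed
  let ?a = "\<lambda>i. a (g i) (g (Suc i))"
  have total: "(\<Sum>j<m. ?a (i + j)) \<noteq> 0" for i
  proof (induction i)
    case 0
    have "(\<Sum>j<m. ?a j) = (\<Sum>j<m. a (h j) (h (Suc j)))" by (rule sum.cong) (simp_all add: gh)
    then show ?case using h(3) by simp
  next
    case (Suc i)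
    have "?a i + (\<Sum>j<m. ?a (Suc i + j)) = (\<Sum>j<Suc m. ?a (i + j))"
      unfolding sum.lessThan_Suc_shift by simp
    also have "\<dots> = (\<Sum>j<m. ?a (i + j)) + ?a i"
      using period[of i] period[of "Suc i"] by simp
    finally show ?case using Suc by simp
  qed
  have "g (i + k) \<noteq> g i" if "0 < k" "k < m" for i k
  proof
    assume eq: "g (i + k) = g i"
    have "(\<Sum>j<k. ?a (i + j)) = 0"
      using least[of k "\<lambda>j. g (i + j)"] that eq edge by simp
    moreover have "(\<Sum>j<m - k. ?a (i + k + j)) = 0"
      using least[of "m - k" "\<lambda>j. g (i + k + j)"] that eq edge period[of i] by (simp add: add.assoc)
    moreover have "(\<Sum>j<m. ?a (i + j)) = (\<Sum>j<k. ?a (i + j)) + (\<Sum>j<m - k. ?a (i + k + j))"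
      using sum_lessThan_add[of "\<lambda>j. ?a (i + j)" k "m - k"] that by (simp add: add.assoc)
    ultimately show False using total[of i] by simp
  qed
  then show ?thesis using that[of g m] period edge total by blast
qed

context symplectic_sequence
begin

lemma closing_swap: "closing v u w \<longleftrightarrow> closing u v w"
proof -
  have "\<omega> v u = - \<omega> u v" "\<omega> u w = - \<omega> w u" "\<omega> w v = - \<omega> v w" by (rule form_swap)+
  then show ?thesis by (auto simp: closing_def add.commute)
qed

lemma adjacent_sym: "adjacent u v \<Longrightarrow> adjacent v u"
  unfolding adjacent_def closing_swap[of v u] form_swap[of v u] by simp

lemma balanced_tripleE:
  assumes "T \<in> balanced_triples \<omega> S"
  obtains x y z where "T = {x, y, z}" "T \<subseteq> set S" "x \<noteq> y" "y \<noteq> z" "z \<noteq> x" "balanced \<omega> x y z"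
    "x + y + z = 0 \<or> - (x + y + z) \<in> set S \<or> count_list S (x + y + z) \<ge> 2"
proof -
  obtain x y z where xyz: "T = {x, y, z}" "T \<subseteq> set S" "x \<noteq> y" "y \<noteq> z" "z \<noteq> x" "balanced \<omega> x y z"
    and t: "let t = x + y + z in t = 0 \<or> t \<noteq> 0 \<and> (count_list S (- t) \<ge> 1 \<or> count_list S t \<ge> 2)"
    using assms unfolding balanced_triples_def by blast
  have "- t \<in> set S" if "count_list S (- t) \<ge> 1" for t
    using that by (metis count_notin not_one_le_zero)
  then show ?thesis using that[OF xyz] t unfolding Let_def by blast
qed

lemma adjacent_if_edge:
  assumes "{u, v} \<in> triple_graph_edges \<omega> S"
  shows "adjacent u v"
proof -
  let ?K = "{T \<in> balanced_triples \<omega> S. {u, v} \<subseteq> T}"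
  have uv: "u \<in> set S" "v \<in> set S" "u \<noteq> v" and three: "card ?K \<ge> 3"
    using assms by (auto simp: triple_graph_edges_def doubleton_eq_iff)
  have closing: "\<exists>w. T = {u, v, w} \<and> closing u v w \<and> \<omega> u v \<noteq> 0" if T: "T \<in> ?K" for T
  proof -
    have "T \<in> balanced_triples \<omega> S" using T by blast
    then obtain x y z where xyz: "T = {x, y, z}" "T \<subseteq> set S" "x \<noteq> y" "y \<noteq> z" "z \<noteq> x"
      "balanced \<omega> x y z"
      "x + y + z = 0 \<or> - (x + y + z) \<in> set S \<or> count_list S (x + y + z) \<ge> 2"
      by (rule balanced_tripleE)
    have swap: "\<omega> y x = - \<omega> x y" "\<omega> z y = - \<omega> y z" "\<omega> x z = - \<omega> z x" by (rule form_swap)+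
    have "{u, v} \<subseteq> {x, y, z}" using T unfolding xyz(1) by blast
    then have "u \<in> {x, y, z}" "v \<in> {x, y, z}" by blast+
    then consider "u = x" "v = y" | "u = y" "v = x" | "u = y" "v = z" | "u = z" "v = y"
      | "u = z" "v = x" | "u = x" "v = z" using uv(3) by auto
    then show ?thesis
    proof cases
      case 1
      then show ?thesis using xyz swap by (intro exI[of _ z]) (auto simp: closing_def balanced_def Let_def)
    next
      case 2
      then show ?thesis using xyz swap
        by (intro exI[of _ z]) (auto simp: closing_def balanced_def Let_def add_ac)
    next
      case 3
      then show ?thesis using xyz swap
        by (intro exI[of _ x]) (auto simp: closing_def balanced_def Let_def add_ac)
    next
      case 4
      then show ?thesis using xyz swap
        by (intro exI[of _ x]) (auto simp: closing_def balanced_def Let_def add_ac)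
    next
      case 5
      then show ?thesis using xyz swap
        by (intro exI[of _ y]) (auto simp: closing_def balanced_def Let_def add_ac)
    next
      case 6
      then show ?thesis using xyz swap
        by (intro exI[of _ y]) (auto simp: closing_def balanced_def Let_def add_ac)
    qed
  qed
  have fin: "finite {w. closing u v w}"
    by (rule finite_subset[of _ "set S"]) (auto simp: closing_def)
  have "?K \<subseteq> (\<lambda>w. {u, v, w}) ` {w. closing u v w}" using closing by blast
  then have "card ?K \<le> card {w. closing u v w}" using fin by (rule surj_card_le[rotated])
  moreover have "?K \<noteq> {}" using three by (metis card.empty not_numeral_le_zero)
  then obtain T where "T \<in> ?K" by (meson all_not_in_conv)
  then have "\<omega> u v \<noteq> 0" using closing[of T] by blast
  ultimately show ?thesis using three uv by (simp add: adjacent_def)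
qed

lemma closed_walk_sum:
  fixes f :: "nat \<Rightarrow> 'k ^ 4"
  assumes "f n = f 0" "\<And>i. i < n \<Longrightarrow> adjacent (f i) (f (Suc i))"
  shows "(\<Sum>i<n. \<omega> (f i) (f (Suc i))) = 0"
proof (rule ccontr)
  assume bad: "(\<Sum>i<n. \<omega> (f i) (f (Suc i))) \<noteq> 0"
  obtain g m where period: "\<And>i. g (i + m) = g i" and edge: "\<And>i. adjacent (g i) (g (Suc i))"
    and total: "\<And>i. (\<Sum>j<m. \<omega> (g (i + j)) (g (Suc (i + j)))) \<noteq> 0"
    and simple: "\<And>i k. 0 < k \<Longrightarrow> k < m \<Longrightarrow> g (i + k) \<noteq> g i"
    using shortest_closed_walk[of f n adjacent \<omega>, OF assms bad] by blast
  have "m \<noteq> 0" using total[of 0] by (cases m) auto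
  moreover have "m \<noteq> 1" using edge[of 0] period[of 0] by (auto simp: adjacent_def)
  moreover have "m \<noteq> 2"
  proof
    assume "m = 2"
    then show False using total[of 0] period[of 0] form_swap[of "g 1" "g 0"]
      by (simp add: numeral_2_eq_2)
  qed
  ultimately have m: "m \<ge> 3" by linarith
  have "\<exists>i<4. g (i + 3) = g i \<and> g i + g (i + 1) + g (i + 2) = 0"
  proof (rule ccontr)
    assume "\<not> (\<exists>i<4. g (i + 3) = g i \<and> g i + g (i + 1) + g (i + 2) = 0)"
    then show False
      using no_walk[of g] edge simple[of 2] m by auto
  qed
  then obtain i where i: "g (i + 3) = g i" "g i + g (i + 1) + g (i + 2) = 0" by blast
  have "m = 3" using simple[of 3 i] i(1) m by fastforce
  have g2: "g (i + 2) = - g i - g (i + 1)" using i(2) by (simp add: eq_neg_iff_add_eq_0 algebra_simps)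
  have "(\<Sum>j<m. \<omega> (g (i + j)) (g (Suc (i + j))))
      = \<omega> (g i) (g (i + 1)) + \<omega> (g (i + 1)) (g (i + 2)) + \<omega> (g (i + 2)) (g (i + 3))"
    unfolding \<open>m = 3\<close> by (simp add: numeral_3_eq_3 numeral_2_eq_2)
  also have "\<dots> = 3 * \<omega> (g i) (g (i + 1))"
    using form_swap[of "g (i + 1)" "g i"] unfolding i(1) g2 by simp
  finally show False using total[of i] three_eq_0 by simp
qed

lemma gradient:
  "\<exists>p. \<forall>u v. {u, v} \<in> triple_graph_edges \<omega> S \<longrightarrow> \<omega> u v = p v - p u"
proof -
  have "\<exists>p. \<forall>u v. adjacent u v \<longrightarrow> \<omega> u v = p v - p u"
    by (rule potential_exists[OF adjacent_sym form_swap closed_walk_sum])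
  then show ?thesis using adjacent_if_edge by blast
qed

end

section \<open>Weights from a potential\<close>

text \<open>A finite system of linear equations \<open>lf T x = b T\<close> for \<open>T \<in> K\<close> either has a solution, or some
  linear combination of the equations reads \<open>0 = s\<close> with \<open>s \<noteq> 0\<close>. The unknowns \<open>x\<close> range over a
  subspace \<open>X\<close> of a function space, which makes the elimination step an instance of the claim.\<close>

lemma fredholm_alternative:
  fixes lf :: "'t \<Rightarrow> ('e \<Rightarrow> 'k::field) \<Rightarrow> 'k"
  assumes "finite K" and lin: "\<And>T x y c. lf T (\<lambda>e. x e + c * y e) = lf T x + c * lf T y"
    and "(\<lambda>_. 0) \<in> X" and "\<And>x y c. x \<in> X \<Longrightarrow> y \<in> X \<Longrightarrow> (\<lambda>e. x e + c * y e) \<in> X"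
  shows "(\<exists>x\<in>X. \<forall>T\<in>K. lf T x = b T) \<or>
    (\<exists>\<kappa>. (\<forall>x\<in>X. (\<Sum>T\<in>K. \<kappa> T * lf T x) = 0) \<and> (\<Sum>T\<in>K. \<kappa> T * b T) \<noteq> 0)"
  using assms(1,3,4)
proof (induction K arbitrary: X b)
  case empty
  then show ?case by auto
next
  case (insert T0 K)
  have sum_upd: "(\<Sum>T\<in>insert T0 K. (\<kappa>(T0 := m)) T * h T) = m * h T0 + (\<Sum>T\<in>K. \<kappa> T * h T)"
    for \<kappa> h :: "'t \<Rightarrow> 'k" and m
  proof -
    have "(\<Sum>T\<in>K. (\<kappa>(T0 := m)) T * h T) = (\<Sum>T\<in>K. \<kappa> T * h T)"
      by (rule sum.cong) (use insert.hyps in auto)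
    then show ?thesis using insert.hyps by simp
  qed
  show ?case
  proof (cases "\<forall>x\<in>X. lf T0 x = 0")
    case zero: True
    show ?thesis
    proof (cases "b T0 = 0")
      case True
      have "(\<exists>x\<in>X. \<forall>T\<in>K. lf T x = b T) \<or>
          (\<exists>\<kappa>. (\<forall>x\<in>X. (\<Sum>T\<in>K. \<kappa> T * lf T x) = 0) \<and> (\<Sum>T\<in>K. \<kappa> T * b T) \<noteq> 0)"
        using insert.IH insert.prems by blast
      then show ?thesis
      proof
        assume "\<exists>x\<in>X. \<forall>T\<in>K. lf T x = b T"
        then show ?thesis using zero True by auto
      next
        assume "\<exists>\<kappa>. (\<forall>x\<in>X. (\<Sum>T\<in>K. \<kappa> T * lf T x) = 0) \<and> (\<Sum>T\<in>K. \<kappa> T * b T) \<noteq> 0"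
        then obtain \<kappa> where "\<forall>x\<in>X. (\<Sum>T\<in>K. \<kappa> T * lf T x) = 0" "(\<Sum>T\<in>K. \<kappa> T * b T) \<noteq> 0" by blast
        then show ?thesis
          by (intro disjI2 exI[of _ "\<kappa>(T0 := 0)"]) (simp only: sum_upd, simp)
      qed
    next
      case False
      show ?thesis
        by (intro disjI2 exI[of _ "(\<lambda>_. 0)(T0 := 1)"]) (use zero False in \<open>simp only: sum_upd, simp\<close>)
    qed
  next
    case False
    then obtain x0 where x0: "x0 \<in> X" "lf T0 x0 \<noteq> 0" by blast
    define s where "s = b T0 / lf T0 x0"
    have s: "s * lf T0 x0 = b T0" using x0(2) by (simp add: s_def)
    let ?X = "{x \<in> X. lf T0 x = 0}" and ?b = "\<lambda>T. b T - s * lf T x0"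
    have "lf T0 (\<lambda>_. 0) = 0" using lin[of T0 "\<lambda>_. 0" "- 1" "\<lambda>_. 0"] by simp
    then have "(\<exists>x\<in>?X. \<forall>T\<in>K. lf T x = ?b T) \<or>
        (\<exists>\<kappa>. (\<forall>x\<in>?X. (\<Sum>T\<in>K. \<kappa> T * lf T x) = 0) \<and> (\<Sum>T\<in>K. \<kappa> T * ?b T) \<noteq> 0)"
      using insert.prems by (intro insert.IH) (auto simp: lin)
    then show ?thesis
    proof
      assume "\<exists>x\<in>?X. \<forall>T\<in>K. lf T x = ?b T"
      then obtain x where x: "x \<in> X" "lf T0 x = 0" "\<forall>T\<in>K. lf T x = ?b T" by blast
      have "(\<lambda>e. x e + s * x0 e) \<in> X" using insert.prems(2) x(1) x0(1) by blast
      moreover have "\<forall>T\<in>insert T0 K. lf T (\<lambda>e. x e + s * x0 e) = b T"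
        using x s by (auto simp: lin)
      ultimately show ?thesis by blast
    next
      assume "\<exists>\<kappa>. (\<forall>x\<in>?X. (\<Sum>T\<in>K. \<kappa> T * lf T x) = 0) \<and> (\<Sum>T\<in>K. \<kappa> T * ?b T) \<noteq> 0"
      then obtain \<kappa> where rel: "\<And>x. x \<in> ?X \<Longrightarrow> (\<Sum>T\<in>K. \<kappa> T * lf T x) = 0"
        and ne: "(\<Sum>T\<in>K. \<kappa> T * ?b T) \<noteq> 0" by blast
      define \<mu> where "\<mu> = (\<Sum>T\<in>K. \<kappa> T * lf T x0)"
      define m where "m = - \<mu> / lf T0 x0"
      have "(\<Sum>T\<in>insert T0 K. (\<kappa>(T0 := m)) T * lf T x) = 0" if "x \<in> X" for x
      proof -
        define r where "r = - lf T0 x / lf T0 x0"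
        have "r * lf T0 x0 = - lf T0 x" using x0(2) by (simp add: r_def)
        then have "(\<lambda>e. x e + r * x0 e) \<in> ?X"
          using insert.prems(2)[OF that x0(1), of r] by (simp add: lin)
        from rel[OF this] have "(\<Sum>T\<in>K. \<kappa> T * (lf T x + r * lf T x0)) = 0"
          by (simp only: lin)
        moreover have "(\<Sum>T\<in>K. \<kappa> T * (lf T x + r * lf T x0)) = (\<Sum>T\<in>K. \<kappa> T * lf T x) + r * \<mu>"
          by (simp add: \<mu>_def sum_distrib_left ring_distribs sum.distrib mult.left_commute)
        moreover have "r * \<mu> = m * lf T0 x" by (simp add: r_def m_def)
        ultimately show ?thesis unfolding sum_upd by (simp add: add.commute)
      qed
      moreover have "(\<Sum>T\<in>insert T0 K. (\<kappa>(T0 := m)) T * b T) = (\<Sum>T\<in>K. \<kappa> T * ?b T)"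
      proof -
        have "(\<Sum>T\<in>K. \<kappa> T * ?b T) = (\<Sum>T\<in>K. \<kappa> T * b T) - s * \<mu>"
          by (simp add: \<mu>_def sum_distrib_left ring_distribs sum_subtractf mult.left_commute)
        moreover have "s * \<mu> = - (m * b T0)" by (simp add: s_def m_def)
        ultimately show ?thesis unfolding sum_upd by simp
      qed
      ultimately show ?thesis using ne by (intro disjI2 exI[of _ "\<kappa>(T0 := m)"]) simp
    qed
  qed
qed

text \<open>The two-element subsets.\<close>

definition pairs :: "'a set \<Rightarrow> 'a set set" where
  "pairs T = {e. e \<subseteq> T \<and> card e = 2}"

lemma pairs_triple:
  assumes "u \<noteq> v" "v \<noteq> w" "w \<noteq> u"
  shows "pairs {u, v, w} = {{u, v}, {v, w}, {w, u}}"
proof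
  show "pairs {u, v, w} \<subseteq> {{u, v}, {v, w}, {w, u}}"
    by (auto simp: pairs_def card_2_iff)
  show "{{u, v}, {v, w}, {w, u}} \<subseteq> pairs {u, v, w}"
    using assms by (auto simp: pairs_def)
qed

lemma sum_pairs_triple:
  assumes "u \<noteq> v" "v \<noteq> w" "w \<noteq> u"
  shows "(\<Sum>e\<in>pairs {u, v, w}. h e) = h {u, v} + h {v, w} + h {w, u}"
  unfolding pairs_triple[OF assms] using assms by (simp add: doubleton_eq_iff add.assoc)

lemma finite_pairs: "finite T \<Longrightarrow> finite (pairs T)"
  by (simp add: pairs_def)

context symplectic_sequence
begin

lemma balanced_triples_subset: "T \<in> balanced_triples \<omega> S \<Longrightarrow> T \<subseteq> set S"
  by (erule balanced_tripleE)

lemma finite_balanced_triples: "finite (balanced_triples \<omega> S)"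
  using balanced_triples_subset finite_subset[of "balanced_triples \<omega> S" "Pow (set S)"] by blast

lemma oriented_triple:
  assumes "T \<in> balanced_triples \<omega> S"
  obtains u v w where "T = {u, v, w}" "u \<noteq> v" "v \<noteq> w" "w \<noteq> u" "\<omega> u v = 1" "\<omega> v w = 1" "\<omega> w u = 1"
proof -
  obtain x y z where xyz: "T = {x, y, z}" "x \<noteq> y" "y \<noteq> z" "z \<noteq> x" and bal: "balanced \<omega> x y z"
    using assms by (rule balanced_tripleE)
  show ?thesis
  proof (cases "\<omega> x y = 1")
    case True
    moreover from this have "\<omega> y z = 1" "\<omega> z x = 1" using bal unfolding balanced_def by metis+
    ultimately show ?thesis by (rule that[OF xyz])
  next
    case False
    then have "\<omega> x y = - 1" "\<omega> y z = - 1" "\<omega> z x = - 1"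
      using bal scalar_cases[of "\<omega> x y"] unfolding balanced_def by metis+
    moreover have "T = {y, x, z}" using xyz by auto
    ultimately show ?thesis
      using that[of y x z] xyz form_swap[of y x] form_swap[of x z] form_swap[of z y] by simp
  qed
qed

lemma of_int_eq_0_dvd:
  assumes "of_int z = (0 :: 'k)"
  shows "3 dvd z"
proof -
  have "of_int z = (of_int (3 * (z div 3) + z mod 3) :: 'k)" by simp
  also have "\<dots> = of_int (z mod 3)"
    unfolding of_int_add of_int_mult of_int_numeral three_eq_0 by simp
  finally have z: "of_int (z mod 3) = (0 :: 'k)" using assms by simp
  have "z mod 3 = 0 \<or> z mod 3 = 1 \<or> z mod 3 = 2" by presburger
  moreover have "(2 :: 'k) \<noteq> 0" unfolding two_eq_minus_one by simp
  ultimately show ?thesis using z by auto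
qed

text \<open>The representative of a scalar of least absolute value.\<close>

definition lift :: "'k \<Rightarrow> int" where
  "lift x = (if x = 0 then 0 else if x = 1 then 1 else - 1)"

lemma of_int_lift [simp]: "of_int (lift x) = x"
  using scalar_cases[of x] by (auto simp: lift_def)

lemma abs_lift: "\<bar>lift x\<bar> \<le> 1"
  by (simp add: lift_def)

text \<open>By the Fredholm alternative it suffices to show \<open>\<Sum> \<kappa> T = 0\<close> for all \<open>\<kappa>\<close> with
  \<open>\<Sum> {\<kappa> T | e \<subseteq> T} = 0\<close> for every pair \<open>e\<close>. Lift \<open>\<kappa>\<close> to \<open>L\<close> with values in \<open>{-1, 0, 1}\<close>. Then
  \<open>M e = \<Sum> {L T | e \<subseteq> T}\<close> is divisible by three, hence zero unless \<open>e\<close> is an edge, because \<open>e\<close> is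
  contained in at most two triples otherwise. Counting pairs gives \<open>\<Sum> M e = 3 * \<Sum> L T\<close>. The oriented
  boundary of each triple is a cycle, so the sum of \<open>M e / 3\<close> times the increment of the
  potential \<open>p\<close> along \<open>e\<close>, in the direction with \<open>\<omega> = 1\<close>, is zero. But these increments are \<open>1\<close>
  on edges, so \<open>\<Sum> L T = \<Sum> M e / 3\<close> vanishes in the field.\<close>

lemma relation_sum_zero:
  fixes \<kappa> :: "('k ^ 4) set \<Rightarrow> 'k"
  assumes p: "\<And>u v. {u, v} \<in> triple_graph_edges \<omega> S \<Longrightarrow> \<omega> u v = p v - p u"
    and rel: "\<And>x. (\<Sum>T\<in>balanced_triples \<omega> S. \<kappa> T * (\<Sum>e\<in>pairs T. x e)) = 0"
  shows "(\<Sum>T\<in>balanced_triples \<omega> S. \<kappa> T) = 0"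
proof -
  let ?K = "balanced_triples \<omega> S"
  define P where "P = (\<Union>T\<in>?K. pairs T)"
  define L where "L T = lift (\<kappa> T)" for T
  define M where "M e = (\<Sum>T\<in>?K. if e \<subseteq> T then L T else 0)" for e
  define q where "q v = lift (p v)" for v
  define d where "d e = (SOME z. \<exists>t h. e = {t, h} \<and> \<omega> t h = 1 \<and> z = q h - q t)" for e
  have finT: "finite T" if "T \<in> ?K" for T
    using oriented_triple[OF that] by (metis finite.simps)
  have finP: "finite P"
    using finite_balanced_triples finT by (auto simp: P_def intro: finite_pairs)
  have d: "d {t, h} = q h - q t" if "\<omega> t h = 1" for t h
  proof -
    have "\<omega> h t \<noteq> 1" using that form_swap[of h t] one_neq_minus_one by auto
    then have "(\<exists>t' h'. {t, h} = {t', h'} \<and> \<omega> t' h' = 1 \<and> z = q h' - q t') \<longleftrightarrow> z = q h - q t" for z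
      using that by (auto simp: doubleton_eq_iff)
    then show ?thesis by (simp add: d_def)
  qed
  have swap: "(\<Sum>e\<in>P. M e * g e) = (\<Sum>T\<in>?K. L T * (\<Sum>e\<in>pairs T. g e))" for g
  proof -
    have "(\<Sum>e\<in>P. M e * g e) = (\<Sum>T\<in>?K. \<Sum>e\<in>P. (if e \<subseteq> T then L T else 0) * g e)"
      unfolding M_def sum_distrib_right by (rule sum.swap)
    also have "\<dots> = (\<Sum>T\<in>?K. L T * (\<Sum>e\<in>pairs T. g e))"
    proof (rule sum.cong[OF refl])
      fix T assume T: "T \<in> ?K"
      have "{e \<in> P. e \<subseteq> T} = pairs T" using T by (auto simp: P_def pairs_def)
      moreover have "(\<Sum>e\<in>P. (if e \<subseteq> T then L T else 0) * g e) = (\<Sum>e\<in>{e \<in> P. e \<subseteq> T}. L T * g e)"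
        using finP by (subst sum.inter_filter) (auto intro: sum.cong)
      ultimately show "(\<Sum>e\<in>P. (if e \<subseteq> T then L T else 0) * g e) = L T * (\<Sum>e\<in>pairs T. g e)"
        by (simp add: sum_distrib_left)
    qed
    finally show ?thesis .
  qed
  have M_dvd: "3 dvd M e" if "e \<in> P" for e
  proof (rule of_int_eq_0_dvd)
    have "card e = 2" using that by (auto simp: P_def pairs_def)
    have "of_int (M e) = (\<Sum>T\<in>?K. \<kappa> T * (\<Sum>e'\<in>pairs T. if e' = e then 1 else 0))"
      unfolding M_def of_int_sum
    proof (rule sum.cong[OF refl])
      fix T assume "T \<in> ?K"
      then show "of_int (if e \<subseteq> T then L T else 0) = \<kappa> T * (\<Sum>e'\<in>pairs T. if e' = e then 1 else 0)"
        using \<open>card e = 2\<close> by (simp add: finT finite_pairs sum.delta L_def) (simp add: pairs_def)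
    qed
    then show "of_int (M e) = (0 :: 'k)" using rel by simp
  qed
  have M_0: "M e = 0" if P: "e \<in> P" and no_edge: "e \<notin> triple_graph_edges \<omega> S" for e
  proof -
    let ?Ke = "{T \<in> ?K. e \<subseteq> T}"
    obtain T where "T \<in> ?K" "e \<subseteq> T" "card e = 2"
      using P unfolding P_def pairs_def by blast
    then obtain u v where "e = {u, v}" "u \<noteq> v" "u \<in> set S" "v \<in> set S"
      using balanced_triples_subset[of T] by (auto simp: card_2_iff)
    then have "\<not> card ?Ke \<ge> 3" using no_edge unfolding triple_graph_edges_def by blast
    have "M e = (\<Sum>T\<in>?Ke. L T)"
      unfolding M_def using finite_balanced_triples by (simp add: sum.inter_filter)
    then have "\<bar>M e\<bar> \<le> (\<Sum>T\<in>?Ke. \<bar>L T\<bar>)" by simp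
    also have "\<dots> \<le> (\<Sum>T\<in>?Ke. 1)" by (rule sum_mono) (simp add: L_def abs_lift)
    finally have "\<bar>M e\<bar> < 3" using \<open>\<not> card ?Ke \<ge> 3\<close> by simp
    then show ?thesis using M_dvd[OF P] by (auto dest: dvd_imp_le_int)
  qed
  define m where "m e = M e div 3" for e
  have M: "M e = 3 * m e" if "e \<in> P" for e using M_dvd[OF that] by (simp add: m_def)
  have "3 * (\<Sum>e\<in>P. m e) = (\<Sum>e\<in>P. M e * 1)" by (simp add: sum_distrib_left M)
  also have "\<dots> = (\<Sum>T\<in>?K. L T * 3)"
    unfolding swap
    by (rule sum.cong[OF refl], erule oriented_triple) (simp add: sum_pairs_triple del: sum_constant)
  also have "\<dots> = 3 * (\<Sum>T\<in>?K. L T)" by (simp add: sum_distrib_left mult.commute)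
  finally have sum_m: "(\<Sum>e\<in>P. m e) = (\<Sum>T\<in>?K. L T)" by simp
  have "3 * (\<Sum>e\<in>P. m e * d e) = (\<Sum>e\<in>P. M e * d e)" by (simp add: sum_distrib_left M mult.assoc)
  also have "\<dots> = (\<Sum>T\<in>?K. L T * 0)"
    unfolding swap
    by (rule sum.cong[OF refl], erule oriented_triple) (simp add: sum_pairs_triple d)
  finally have sum_md: "(\<Sum>e\<in>P. m e * d e) = 0" by simp
  have "of_int (m e * d e) = (of_int (m e) :: 'k)" if P: "e \<in> P" for e
  proof (cases "e \<in> triple_graph_edges \<omega> S")
    case True
    obtain T where T: "T \<in> ?K" "e \<in> pairs T" using P unfolding P_def by blast
    obtain u v w where uvw: "T = {u, v, w}" "u \<noteq> v" "v \<noteq> w" "w \<noteq> u" "\<omega> u v = 1" "\<omega> v w = 1" "\<omega> w u = 1"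
      using T(1) by (rule oriented_triple)
    have "\<exists>t h. e = {t, h} \<and> \<omega> t h = 1"
      using T(2) uvw unfolding uvw(1) pairs_triple[OF uvw(2-4)] by blast
    then obtain t h where th: "e = {t, h}" "\<omega> t h = 1" by blast
    have "of_int (d e) = p h - p t" using d[OF th(2)] by (simp add: th(1) q_def)
    also have "\<dots> = 1" using p[of t h] True th by simp
    finally show ?thesis by simp
  next
    case False
    then show ?thesis using M_0[OF P] by (simp add: m_def)
  qed
  then have "of_int (\<Sum>e\<in>P. m e * d e) = (of_int (\<Sum>e\<in>P. m e) :: 'k)"
    unfolding of_int_sum by (rule sum.cong[OF refl])
  then have "of_int (\<Sum>T\<in>?K. L T) = (0 :: 'k)" by (simp add: sum_md sum_m)
  then show ?thesis by (simp add: L_def)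
qed

lemma weights:
  assumes p: "\<And>u v. {u, v} \<in> triple_graph_edges \<omega> S \<Longrightarrow> \<omega> u v = p v - p u"
  shows "\<exists>x. \<forall>T \<in> balanced_triples \<omega> S. (\<Sum>e\<in>pairs T. x e) = (1 :: 'k)"
proof -
  have "(\<exists>x\<in>UNIV. \<forall>T\<in>balanced_triples \<omega> S. (\<Sum>e\<in>pairs T. x e) = (1 :: 'k)) \<or>
    (\<exists>\<kappa>. (\<forall>x\<in>UNIV. (\<Sum>T\<in>balanced_triples \<omega> S. \<kappa> T * (\<Sum>e\<in>pairs T. x e)) = (0 :: 'k)) \<and>
      (\<Sum>T\<in>balanced_triples \<omega> S. \<kappa> T * 1) \<noteq> 0)"
    by (rule fredholm_alternative)
      (simp_all add: finite_balanced_triples sum.distrib sum_distrib_left)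
  moreover have "(\<Sum>T\<in>balanced_triples \<omega> S. \<kappa> T * 1) = 0"
    if "\<forall>x\<in>UNIV. (\<Sum>T\<in>balanced_triples \<omega> S. \<kappa> T * (\<Sum>e\<in>pairs T. x e)) = (0 :: 'k)" for \<kappa>
    using relation_sum_zero[OF p, of \<kappa>] that by simp
  ultimately show ?thesis by blast
qed

end

theorem theorem6p1:
  fixes \<omega> :: "'k::field ^ 4 \<Rightarrow> 'k ^ 4 \<Rightarrow> 'k" and S :: "('k ^ 4) list"
  assumes "CARD('k) = 3"
    and "alternating_form \<omega>" and "nondegenerate_on \<omega> UNIV"
    and "length S = 12" and "0 \<notin> set S"
    and "\<And>U. subspace_of_dim 1 U \<Longrightarrow> terms_in S U \<le> 2"
    and "\<And>U. subspace_of_dim 2 U \<Longrightarrow> isotropic \<omega> U \<Longrightarrow> terms_in S U \<le> 3"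
    and "\<And>U. subspace_of_dim 2 U \<Longrightarrow> nondegenerate_on \<omega> U \<Longrightarrow> terms_in S U \<le> 6"
    and "\<And>U. subspace_of_dim 3 U \<Longrightarrow> terms_in S U \<le> 8"
  shows "(\<exists>p :: 'k ^ 4 \<Rightarrow> 'k. \<forall>u v. {u, v} \<in> triple_graph_edges \<omega> S \<longrightarrow> \<omega> u v = p v - p u) \<and>
    (\<exists>\<rho> :: 'k ^ 4 \<Rightarrow> 'k ^ 4 \<Rightarrow> 'k.
       (\<forall>u\<in>set S. \<forall>v\<in>set S. \<omega> u v \<noteq> 0 \<longrightarrow> \<rho> u v = \<rho> v u) \<and>
       (\<forall>u v w. {u, v, w} \<in> balanced_triples \<omega> S \<longrightarrow> \<rho> u v + \<rho> v w + \<rho> w u = 1))"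
proof -
  interpret symplectic_sequence \<omega> S
    by unfold_locales (fact assms)+
  obtain p where p: "\<And>u v. {u, v} \<in> triple_graph_edges \<omega> S \<Longrightarrow> \<omega> u v = p v - p u"
    using gradient by blast
  obtain x where x: "\<And>T. T \<in> balanced_triples \<omega> S \<Longrightarrow> (\<Sum>e\<in>pairs T. x e) = (1 :: 'k)"
    using weights[OF p] by blast
  have "x {u, v} + x {v, w} + x {w, u} = 1" if T: "{u, v, w} \<in> balanced_triples \<omega> S" for u v w
  proof -
    obtain a b c where "{u, v, w} = {a, b, c}" "a \<noteq> b" "b \<noteq> c" "c \<noteq> a"
      using T by (rule balanced_tripleE)
    then have "card {u, v, w} = 3" by simp
    then have "u \<noteq> v" "v \<noteq> w" "w \<noteq> u" by (auto simp: card_insert_if split: if_splits)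
    from sum_pairs_triple[OF this, of x] show ?thesis using x[OF T] by simp
  qed
  then show ?thesis
    using p by (intro conjI exI[of _ p] exI[of _ "\<lambda>u v. x {u, v}"]) (auto simp: insert_commute)
qed

end
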